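(* Let $k\geq 3$ and $m$ be integers with $k\leq m^2/2$ and $m\geq \lfloor k/2\rfloor+1$, and let $\Delta=P_k$ be the $k$-path in $\mathbf{K}_{m,m}$ with edges $\{R_i,C_i\}$ for $1\leq i\leq \lceil k/2\rceil$ and $\{R_{i+1},C_i\}$ for $1\leq i\leq \lfloor k/2\rfloor$. Let $\mathcal{D}(\Delta)$, $\widehat{\mathcal{D}}(\Delta)$ be as defined in the context. Then $\widehat{\mathcal{D}}(\Delta)$ is not a $3$-design, and $\widehat{\mathcal{D}}(\Delta)$ is a $2$-design if and only if $m=k-1$. Moreover, if $m=k-1$, then: (a) if $k$ is odd then (i) $\widehat{\mathcal{D}}(\Delta)=\mathcal{D}(\Delta)$, and hence $\mathcal{D}(\Delta)$ is a $2$-design, and (ii) $\widehat{\mathcal{D}}(\Delta)$ is a $2$-$((k-1)^2,k,\lambda)$ design with $$\lambda=\frac{(k-1)!\,(k-3)!}{\left(\left(\frac{k-3}{2}\right)!\right)^2};$$ (b) if $k$ is even then (i) $\widehat{\mathcal{D}}(\Delta)\neq\mathcal{D}(\Delta)$ and $\mathcal{D}(\Delta)$ is not a $2$-design, and (ii) $\widehat{\mathcal{D}}(\Delta)$ is a $2$-$((k-1)^2,k,\lambda)$ design with $$\lambda=\frac{(k-1)!\,(k-3)!}{\left(\frac{k}{2}-2\right)!\,\left(\frac{k}{2}-1\right)!}.$$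
   Context: Let $\mathcal{R}=\{R_1,\dots,R_m\}$ and $\mathcal{C}=\{C_1,\dots,C_m\}$ be disjoint sets of size $m$, let $\mathcal{P}=\mathcal{R}\times\mathcal{C}$, and let $\mathbf{K}_{m,m}$ be the complete bipartite graph with vertex set $\mathcal{R}\cup\mathcal{C}$ and edges all pairs $\{R,C\}$ with $R\in\mathcal{R}$, $C\in\mathcal{C}$. Subgraphs $\Delta$ of $\mathbf{K}_{m,m}$ are identified with their edge sets. For a subgraph $\Delta$ put $B(\Delta)=\{(R,C)\in\mathcal{P} : \{R,C\}\text{ is an edge of }\Delta\}$. Let $K=\mathrm{Sym}(\mathcal{R})\times\mathrm{Sym}(\mathcal{C})$ act on $\mathbf{K}_{m,m}$ and on $\mathcal{P}$ in the natural way; let $\tau$ be the automorphism of $\mathbf{K}_{m,m}$ interchanging $R_i$ and $C_i$ for each $i$, which acts on $\mathcal{P}$ by $(R_i,C_j)\mapsto(R_j,C_i)$; and let $G=\langle K,\tau\rangle\cong \mathrm{S}_m\wr\mathrm{S}_2$. Define the incidence structures $\mathcal{D}(\Delta)=(\mathcal{P},\{B(\Delta^g) : g\in K\})$ and $\widehat{\mathcal{D}}(\Delta)=(\mathcal{P},\{B(\Delta^g) : g\in G\})$, with incidence being inclusion. An incidence structure with point set $\mathcal{P}$ and blocks that are subsets of $\mathcal{P}$ is a $t$-$(v,k,\lambda)$ design ($t,v,k,\lambda$ positive integers) if $|\mathcal{P}|=v$, every block has size $k$, and every $t$-subset of $\mathcal{P}$ lies in exactly $\lambda$ blocks; it is a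 $t$-design if this holds for some $v,k,\lambda$. *)

theory Defs
  imports Complex_Main "HOL-Algebra.Generated_Groups" "HOL-Combinatorics.Permutations"
begin

text \<open>An incidence structure is a pair of a point set and a set of blocks; blocks are sets
  of points and incidence is membership.\<close>

type_synonym 'p incidence_structure = "'p set \<times> 'p set set"

definition is_design ::
    "nat \<Rightarrow> nat \<Rightarrow> nat \<Rightarrow> nat \<Rightarrow> 'p incidence_structure \<Rightarrow> bool" where
  "is_design t v k l D \<longleftrightarrow>
     0 < t \<and> 0 < v \<and> 0 < k \<and> 0 < l \<and>
     card (fst D) = v \<and>
     (\<forall>b\<in>snd D. b \<subseteq> fst D \<and> card b = k) \<and>
     (\<forall>T. T \<subseteq> fst D \<and> card T = t \<longrightarrow> card {b \<in> snd D. T \<subseteq> b} = l)"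

definition is_t_design :: "nat \<Rightarrow> 'p incidence_structure \<Rightarrow> bool" where
  "is_t_design t D \<longleftrightarrow> (\<exists>v k l. is_design t v k l D)"

text \<open>The two parts of the bipartition are enumerated by functions \<open>R\<close> and \<open>C\<close> on \<open>{1..m}\<close>,
  required (where used) to be injective there with disjoint images.\<close>

definition vpart :: "(nat \<Rightarrow> 'v) \<Rightarrow> nat \<Rightarrow> 'v set" where
  "vpart X m = X ` {1..m}"

definition points :: "(nat \<Rightarrow> 'v) \<Rightarrow> (nat \<Rightarrow> 'v) \<Rightarrow> nat \<Rightarrow> ('v \<times> 'v) set" where
  "points R C m = vpart R m \<times> vpart C m"

text \<open>A subgraph is identified with its set of edges, each edge being a two-element vertex set.\<close>

definition block :: "(nat \<Rightarrow> 'v) \<Rightarrow> (nat \<Rightarrow> 'v) \<Rightarrow> nat \<Rightarrow> 'v set set \<Rightarrow> ('v \<times> 'v) set" where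
  "block R C m \<Delta> = {(x, y) \<in> points R C m. {x, y} \<in> \<Delta>}"

definition symm_grp :: "'v set \<Rightarrow> ('v \<Rightarrow> 'v) monoid" where
  "symm_grp V = \<lparr>carrier = {g. g permutes V}, monoid.mult = (\<circ>), one = id\<rparr>"

text \<open>A permutation of one part fixes every other vertex, so the pair \<open>(\<sigma>, \<rho>)\<close> in the direct
  product of the two symmetric groups acts on the vertices as \<open>\<sigma> \<circ> \<rho>\<close>.\<close>

definition K_group :: "(nat \<Rightarrow> 'v) \<Rightarrow> (nat \<Rightarrow> 'v) \<Rightarrow> nat \<Rightarrow> ('v \<Rightarrow> 'v) set" where
  "K_group R C m = {\<sigma> \<circ> \<rho> | \<sigma> \<rho>. \<sigma> permutes vpart R m \<and> \<rho> permutes vpart C m}"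

text \<open>The involution \<open>\<tau>\<close>.\<close>

definition interchange :: "(nat \<Rightarrow> 'v) \<Rightarrow> (nat \<Rightarrow> 'v) \<Rightarrow> nat \<Rightarrow> 'v \<Rightarrow> 'v" where
  "interchange R C m x =
     (if x \<in> vpart R m then C (the_inv_into {1..m} R x)
      else if x \<in> vpart C m then R (the_inv_into {1..m} C x)
      else x)"

definition G_group :: "(nat \<Rightarrow> 'v) \<Rightarrow> (nat \<Rightarrow> 'v) \<Rightarrow> nat \<Rightarrow> ('v \<Rightarrow> 'v) set" where
  "G_group R C m = generate (symm_grp (vpart R m \<union> vpart C m)) (K_group R C m \<union> {interchange R C m})"

definition act_graph :: "('v \<Rightarrow> 'v) \<Rightarrow> 'v set set \<Rightarrow> 'v set set" where
  "act_graph g \<Delta> = (\<lambda>e. g ` e) ` \<Delta>"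

definition design ::
    "(nat \<Rightarrow> 'v) \<Rightarrow> (nat \<Rightarrow> 'v) \<Rightarrow> nat \<Rightarrow> 'v set set \<Rightarrow> ('v \<times> 'v) incidence_structure" where
  "design R C m \<Delta> = (points R C m, {block R C m (act_graph g \<Delta>) | g. g \<in> K_group R C m})"

definition design_hat ::
    "(nat \<Rightarrow> 'v) \<Rightarrow> (nat \<Rightarrow> 'v) \<Rightarrow> nat \<Rightarrow> 'v set set \<Rightarrow> ('v \<times> 'v) incidence_structure" where
  "design_hat R C m \<Delta> = (points R C m, {block R C m (act_graph g \<Delta>) | g. g \<in> G_group R C m})"

text \<open>The path with \<open>k\<close> edges; \<open>(k + 1) div 2\<close> is the ceiling of \<open>k / 2\<close>.\<close>

definition k_path :: "(nat \<Rightarrow> 'v) \<Rightarrow> (nat \<Rightarrow> 'v) \<Rightarrow> nat \<Rightarrow> 'v set set" where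
  "k_path R C k =
     {{R i, C i} | i. 1 \<le> i \<and> i \<le> (k + 1) div 2} \<union>
     {{R (i + 1), C i} | i. 1 \<le> i \<and> i \<le> k div 2}"

lemma group_symm_grp: "group (symm_grp V)"
proof (rule groupI)
  fix g assume "g \<in> carrier (symm_grp V)"
  then have "g permutes V" by (simp add: symm_grp_def)
  then show "\<exists>h\<in>carrier (symm_grp V). h \<otimes>\<^bsub>symm_grp V\<^esub> g = \<one>\<^bsub>symm_grp V\<^esub>"
    by (intro bexI[of _ "inv_into UNIV g"])
      (auto simp: symm_grp_def permutes_inv permutes_inv_o)
qed (auto simp: symm_grp_def permutes_compose permutes_id o_assoc)

lemma interchange_simps:
  assumes "inj_on R {1..m}" "inj_on C {1..m}" "vpart R m \<inter> vpart C m = {}" "i \<in> {1..m}"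
  shows "interchange R C m (R i) = C i" "interchange R C m (C i) = R i"
proof -
  have "R i \<in> vpart R m" "C i \<in> vpart C m"
    using assms(4) by (auto simp: vpart_def)
  moreover from this(2) have "C i \<notin> vpart R m"
    using assms(3) by blast
  ultimately show "interchange R C m (R i) = C i" "interchange R C m (C i) = R i"
    using assms by (simp_all add: interchange_def the_inv_into_f_f)
qed

lemma interchange_permutes:
  assumes "inj_on R {1..m}" "inj_on C {1..m}" "vpart R m \<inter> vpart C m = {}"
  shows "interchange R C m permutes (vpart R m \<union> vpart C m)"
proof -
  have inv: "interchange R C m (interchange R C m x) = x" for x
  proof (cases "x \<in> vpart R m \<union> vpart C m")
    case True
    then show ?thesis using interchange_simps[OF assms] by (auto simp: vpart_def)
  next
    case False
    then show ?thesis by (simp add: interchange_def)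
  qed
  then show ?thesis
    unfolding permutes_def by (metis UnCI interchange_def)
qed

lemma K_group_subset: "K_group R C m \<subseteq> carrier (symm_grp (vpart R m \<union> vpart C m))"
  by (auto simp: K_group_def symm_grp_def intro!: permutes_compose intro: permutes_subset)

end

theory Submission
  imports Defs
begin

text \<open>
  A path is stored as the list of its vertices, so the copies of the \<open>k\<close>-path in the complete
  bipartite graph are the edge sets of repetition-free alternating lists of length \<open>k + 1\<close>, each
  copy arising from exactly two lists that are reversals of each other.
  Under the full automorphism group all pairs of adjacent edges are equivalent, and so are all pairs
  of disjoint edges. With \<open>b\<close> copies, a copy contains \<open>k - 1\<close> adjacent pairs among its \<open>k choose 2\<close>
  pairs of edges, while the graph has \<open>m\<^sup>2 (m - 1)\<close> adjacent pairs among \<open>m\<^sup>2 choose 2\<close>; double counting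
  shows that the two types of pairs lie in equally many copies iff \<open>m = k - 1\<close>, and then each lies in
  \<open>b / (m (m - 1))\<close> copies. Three edges at a common vertex lie in no path, so there is no \<open>3\<close>-design.
\<close>

section \<open>Paths as vertex lists\<close>

definition path_edges :: "'a list \<Rightarrow> 'a set set" where
  "path_edges ws = {{ws ! i, ws ! Suc i} | i. Suc i < length ws}"

text \<open>The two sets trade places at each step, so an induction that generalises over both of
  them handles lists starting in either part.\<close>

primrec alternating :: "'a set \<Rightarrow> 'a set \<Rightarrow> 'a list \<Rightarrow> bool" where
  "alternating A B [] = True"
| "alternating A B (x # xs) = (x \<in> A \<and> alternating B A xs)"

definition alt_lists :: "'a set \<Rightarrow> 'a set \<Rightarrow> nat \<Rightarrow> 'a list set" where
  "alt_lists A B n = {ws. alternating A B ws \<and> distinct ws \<and> length ws = n}"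

lemma path_edges_image: "path_edges ws = (\<lambda>i. {ws ! i, ws ! Suc i}) ` {..<length ws - 1}"
  unfolding path_edges_def by (auto simp: image_iff less_diff_conv)

lemma path_edges_3: "path_edges [a, b, c] = {{a, b}, {b, c}}"
  by (auto simp: path_edges_image lessThan_Suc numeral_2_eq_2)

lemma edge_eq_iff:
  assumes "distinct ws" "Suc i < length ws" "Suc j < length ws"
  shows "{ws ! i, ws ! Suc i} = {ws ! j, ws ! Suc j} \<longleftrightarrow> i = j"
  using assms by (auto simp: doubleton_eq_iff nth_eq_iff_index_eq)

lemma inj_on_edge:
  assumes "distinct ws"
  shows "inj_on (\<lambda>i. {ws ! i, ws ! Suc i}) {..<length ws - 1}"
  using assms by (intro inj_onI) (auto simp: edge_eq_iff less_diff_conv)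

lemma card_path_edges:
  assumes "distinct ws"
  shows "card (path_edges ws) = length ws - 1"
  using card_image[OF inj_on_edge[OF assms]] by (simp add: path_edges_image)

lemma path_edges_map: "path_edges (map g ws) = (`) g ` path_edges ws"
proof -
  have "path_edges (map g ws) = (\<lambda>i. {map g ws ! i, map g ws ! Suc i}) ` {..<length ws - 1}"
    by (simp add: path_edges_image)
  also have "\<dots> = (\<lambda>i. g ` {ws ! i, ws ! Suc i}) ` {..<length ws - 1}"
    by (intro image_cong) auto
  finally show ?thesis by (simp add: path_edges_image image_image)
qed

lemma path_edges_rev: "path_edges (rev ws) = path_edges ws"
proof -
  have sub: "path_edges (rev vs) \<subseteq> path_edges vs" for vs :: "'a list"
  proof
    fix e assume "e \<in> path_edges (rev vs)"
    then obtain i where i: "Suc i < length vs" and e: "e = {rev vs ! i, rev vs ! Suc i}"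
      by (auto simp: path_edges_def)
    let ?j = "length vs - Suc (Suc i)"
    have "rev vs ! i = vs ! Suc ?j" "rev vs ! Suc i = vs ! ?j" "Suc ?j < length vs"
      using i by (auto simp: rev_nth Suc_diff_Suc)
    then show "e \<in> path_edges vs"
      using e unfolding path_edges_def by (auto simp: insert_commute)
  qed
  from sub[of ws] sub[of "rev ws"] show ?thesis by simp
qed

lemma vertex_of_path_edges:
  assumes "{x, y} \<in> path_edges ws"
  obtains j where "j < length ws" "x = ws ! j"
proof -
  obtain i where "Suc i < length ws" "{x, y} = {ws ! i, ws ! Suc i}"
    using assms by (auto simp: path_edges_def)
  then have "x = ws ! i \<or> x = ws ! Suc i" "i < length ws" by (auto simp: doubleton_eq_iff)
  then show thesis using that \<open>Suc i < length ws\<close> by blast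
qed

text \<open>A vertex of a path has degree at most two. Recovering a path from its edges, locating
  two-edge subpaths and excluding stars all rest on this.\<close>

lemma edge_in_path_edges_iff:
  assumes "distinct ws" "j < length ws"
  shows "{ws ! j, y} \<in> path_edges ws \<longleftrightarrow>
    (Suc j < length ws \<and> y = ws ! Suc j) \<or> (0 < j \<and> y = ws ! (j - 1))"
proof
  assume "{ws ! j, y} \<in> path_edges ws"
  then obtain i where i: "Suc i < length ws" "{ws ! j, y} = {ws ! i, ws ! Suc i}"
    by (auto simp: path_edges_def)
  then show "(Suc j < length ws \<and> y = ws ! Suc j) \<or> (0 < j \<and> y = ws ! (j - 1))"
    using assms by (auto simp: doubleton_eq_iff nth_eq_iff_index_eq)
next
  assume "(Suc j < length ws \<and> y = ws ! Suc j) \<or> (0 < j \<and> y = ws ! (j - 1))"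
  then show "{ws ! j, y} \<in> path_edges ws"
  proof
    assume "0 < j \<and> y = ws ! (j - 1)"
    then have "{ws ! j, y} = {ws ! (j - 1), ws ! Suc (j - 1)}" "Suc (j - 1) < length ws"
      using assms by auto
    then show ?thesis unfolding path_edges_def by blast
  qed (auto simp: path_edges_def)
qed

text \<open>Walking along the path determines it: the next vertex is a neighbour of the current one,
  and repetition-freeness excludes the neighbour just left.\<close>

lemma path_edges_eq_same_start:
  assumes "distinct us" "distinct ws" "length us = length ws"
    and eq: "path_edges us = path_edges ws" and start: "us ! 0 = ws ! 0"
  shows "us = ws"
proof (rule nth_equalityI)
  fix i assume "i < length us"
  then show "us ! i = ws ! i"
  proof (induction i rule: less_induct)
    case (less i)
    show ?case
    proof (cases i)
      case 0
      then show ?thesis using start by simp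
    next
      case (Suc j)
      have j: "us ! j = ws ! j" using less Suc by simp
      have "{us ! j, us ! i} \<in> path_edges us"
        using less.prems Suc unfolding path_edges_def by auto
      then have "{ws ! j, us ! i} \<in> path_edges ws" using eq j by simp
      then have "us ! i = ws ! i \<or> (0 < j \<and> us ! i = ws ! (j - 1))"
        using edge_in_path_edges_iff[of ws j "us ! i"] assms less.prems Suc by auto
      moreover have "us ! i \<noteq> ws ! (j - 1)" if "0 < j"
      proof -
        have "us ! (j - 1) = ws ! (j - 1)" using less Suc by simp
        moreover have "us ! i \<noteq> us ! (j - 1)"
          using assms(1) less.prems Suc that by (auto simp: nth_eq_iff_index_eq)
        ultimately show ?thesis by simp
      qed
      ultimately show ?thesis by blast
    qed
  qed
qed (use assms in simp)

text \<open>The first vertex of \<open>us\<close> has a single neighbour, so it must be an end of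
  \<open>ws\<close>. If it is the last vertex, reversing \<open>ws\<close> reduces to the case of a
  common start.\<close>

lemma path_edges_eqD:
  assumes "distinct us" "distinct ws" "length us = length ws" "2 \<le> length ws"
    and eq: "path_edges us = path_edges ws"
  shows "us = ws \<or> us = rev ws"
proof -
  have u01: "{us ! 0, us ! Suc 0} \<in> path_edges us"
    using assms unfolding path_edges_def by force
  then obtain l where l: "l < length ws" "us ! 0 = ws ! l"
    using vertex_of_path_edges[OF u01[unfolded eq]] by blast
  have only: "y = us ! Suc 0" if "{ws ! l, y} \<in> path_edges ws" for y
  proof -
    have "{us ! 0, y} \<in> path_edges us" using that eq l(2) by simp
    moreover have "0 < length us" using assms by linarith
    ultimately show ?thesis using edge_in_path_edges_iff[OF assms(1), of 0 y] by blast
  qed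
  \<comment> \<open>An inner position of \<open>ws\<close> would have two different neighbours, yet
    both would have to be the second vertex of \<open>us\<close>.\<close>
  have "l = 0 \<or> Suc l = length ws"
  proof (rule ccontr)
    assume "\<not> ?thesis"
    then have "0 < l" "Suc l < length ws" using l by auto
    then have "ws ! Suc l = us ! Suc 0" "ws ! (l - 1) = us ! Suc 0"
      using only edge_in_path_edges_iff[of ws l] assms(2) l(1) by auto
    then have "ws ! Suc l = ws ! (l - 1)" by simp
    then show False using \<open>Suc l < length ws\<close> assms(2) \<open>0 < l\<close>
      by (auto simp: nth_eq_iff_index_eq)
  qed
  then show ?thesis
  proof
    assume "l = 0"
    then show ?thesis using path_edges_eq_same_start assms l by blast
  next
    assume "Suc l = length ws"
    then have "us ! 0 = rev ws ! 0" using l by (simp add: rev_nth flip: \<open>Suc l = length ws\<close>)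
    then have "us = rev ws"
      by (intro path_edges_eq_same_start) (use assms path_edges_rev in auto)
    then show ?thesis ..
  qed
qed

text \<open>On a set closed under reversal, each fibre of \<open>path_edges\<close> is a list
  together with its reversal; these differ because \<open>2 \<le> n\<close> makes first and last
  entries distinct.\<close>

lemma card_path_edges_image:
  assumes "finite S" "\<And>ws. ws \<in> S \<Longrightarrow> distinct ws \<and> length ws = n" "2 \<le> n"
    and rev: "\<And>ws. ws \<in> S \<Longrightarrow> rev ws \<in> S"
  shows "card S = 2 * card (path_edges ` S)"
proof -
  have "card {ws \<in> S. path_edges ws = e} = 2" if e: "e \<in> path_edges ` S" for e
  proof -
    from e obtain ws where ws: "ws \<in> S" "e = path_edges ws" by blast
    have d: "distinct ws" "length ws = n" using assms ws by auto
    have "{us \<in> S. path_edges us = e} = {ws, rev ws}"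
      using path_edges_eqD[of _ ws] assms ws d path_edges_rev rev by auto
    moreover have "ws \<noteq> rev ws"
    proof
      assume "ws = rev ws"
      then have "ws ! 0 = rev ws ! 0" by simp
      then have "ws ! 0 = ws ! (n - 1)" using d assms(3) by (simp add: rev_nth)
      then show False using d assms(3) by (auto simp: nth_eq_iff_index_eq)
    qed
    ultimately show ?thesis by simp
  qed
  then show ?thesis
    using sum.image_gen[OF assms(1), of "\<lambda>_. 1::nat" path_edges]
      assms(1) by simp
qed

section \<open>Alternating lists: reversal, counting, and transitivity of permutations\<close>

lemma alternating_iff_nth:
  "alternating A B ws \<longleftrightarrow> (\<forall>i<length ws. ws ! i \<in> (if even i then A else B))"
proof (induction ws arbitrary: A B)
  case (Cons x xs)
  show ?case by (simp add: Cons All_less_Suc2) (rule conj_cong; auto)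
qed simp

lemma alternating_map: "alternating A B ws \<Longrightarrow> alternating (g ` A) (g ` B) (map g ws)"
  by (induction ws arbitrary: A B) auto

lemma alternating_set: "alternating A B ws \<Longrightarrow> set ws \<subseteq> A \<union> B"
  by (induction ws arbitrary: A B) auto

lemma alternating_snoc:
  "alternating A B (xs @ [x]) \<longleftrightarrow> alternating A B xs \<and> x \<in> (if even (length xs) then A else B)"
  by (induction xs arbitrary: A B) auto

lemma alternating_rev:
  "alternating A B ws \<Longrightarrow>
    if odd (length ws) then alternating A B (rev ws) else alternating B A (rev ws)"
proof (induction ws arbitrary: A B)
  case (Cons x xs)
  then show ?case using Cons.IH[of B A] by (auto simp: alternating_snoc split: if_splits)
qed simp

text \<open>The list starts in \<open>B\<close>, so it records how many vertices of \<open>A\<close>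
  are already taken when a further vertex of \<open>A\<close> is to be prepended.\<close>

lemma card_inter_alternating:
  assumes "alternating B A ws" "distinct ws" "A \<inter> B = {}"
  shows "card (A \<inter> set ws) = length ws div 2 \<and> card (B \<inter> set ws) = (length ws + 1) div 2"
  using assms
proof (induction ws arbitrary: A B)
  case (Cons x xs)
  have "alternating A B xs" "distinct xs" "B \<inter> A = {}" "x \<in> B" "x \<notin> A" "x \<notin> set xs"
    using Cons.prems by auto
  then have "card (B \<inter> set xs) = length xs div 2" "card (A \<inter> set xs) = (length xs + 1) div 2"
    using Cons.IH by auto
  moreover have "A \<inter> set (x # xs) = A \<inter> set xs" "B \<inter> set (x # xs) = insert x (B \<inter> set xs)"
    using \<open>x \<in> B\<close> \<open>x \<notin> A\<close> by auto
  ultimately show ?case using \<open>x \<notin> set xs\<close> by simp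
qed simp

lemma finite_alt_lists:
  assumes "finite A" "finite B"
  shows "finite (alt_lists A B n)"
proof (rule finite_subset)
  show "alt_lists A B n \<subseteq> {ws. set ws \<subseteq> A \<union> B \<and> length ws = n}"
    using alternating_set by (auto simp: alt_lists_def)
  show "finite {ws. set ws \<subseteq> A \<union> B \<and> length ws = n}"
    using assms by (intro finite_lists_length_eq) simp
qed

text \<open>Lists are built by prepending: in front of a list of length \<open>n\<close> starting in
  \<open>B\<close> there are \<open>m - n div 2\<close> free vertices of \<open>A\<close>. For
  \<open>n\<close> beyond \<open>2 * m\<close> a factor of the product vanishes, in accordance with
  the truncated subtraction.\<close>

lemma card_alt_lists:
  assumes "finite A" "finite B" "card A = m" "card B = m" "A \<inter> B = {}"
  shows "card (alt_lists A B n) = (\<Prod>i<n. m - i div 2)"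
  using assms
proof (induction n arbitrary: A B)
  case 0
  have "alt_lists A B 0 = {[]}" by (auto simp: alt_lists_def)
  then show ?case by simp
next
  case (Suc n)
  have eq: "alt_lists A B (Suc n) = (\<lambda>(ws, x). x # ws) ` (SIGMA ws:alt_lists B A n. A - set ws)"
    by (auto simp: alt_lists_def image_iff length_Suc_conv)
  have c: "card (A - set ws) = m - n div 2" if "ws \<in> alt_lists B A n" for ws
    using that card_inter_alternating[of B A ws] Suc.prems
    by (simp add: alt_lists_def card_Diff_subset_Int)
  have "card (alt_lists A B (Suc n)) = card (SIGMA ws:alt_lists B A n. A - set ws)"
    unfolding eq by (rule card_image) (auto simp: inj_on_def)
  also have "\<dots> = (\<Sum>ws\<in>alt_lists B A n. card (A - set ws))"
    by (rule card_SigmaI) (use Suc.prems finite_alt_lists in auto)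
  also have "\<dots> = card (alt_lists B A n) * (m - n div 2)" by (simp add: c)
  also have "\<dots> = (\<Prod>i<n. m - i div 2) * (m - n div 2)"
    using Suc.IH[of B A] Suc.prems by (simp add: Int_commute)
  finally show ?case by simp
qed

text \<open>Induction on the lists: a permutation matching the tails is corrected by one
  transposition inside \<open>A\<close> that also matches the heads.\<close>

lemma ex_permutes_map_alternating:
  assumes "alternating A B xs" "alternating A B ys" "distinct xs" "distinct ys"
    "length xs = length ys" "A \<inter> B = {}"
  shows "\<exists>g. g permutes (A \<union> B) \<and> g ` A = A \<and> g ` B = B \<and> map g xs = ys"
  using assms
proof (induction xs arbitrary: ys A B)
  case Nil
  then show ?case by (intro exI[of _ id]) (auto simp: permutes_def)
next
  case (Cons x xs)
  obtain y ys' where ys: "ys = y # ys'" using Cons.prems(5) by (cases ys) auto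
  have "\<exists>g. g permutes (B \<union> A) \<and> g ` B = B \<and> g ` A = A \<and> map g xs = ys'"
    by (rule Cons.IH) (use Cons.prems ys in auto)
  then obtain g where g: "g permutes (A \<union> B)" "g ` A = A" "g ` B = B" "map g xs = ys'"
    unfolding Un_commute[of B A] by blast
  let ?t = "transpose (g x) y"
  have A: "g x \<in> A" "y \<in> A" using Cons.prems ys g by auto
  \<comment> \<open>Neither \<open>g x\<close> nor \<open>y\<close> occurs in the tail
    \<open>ys'\<close>, so the transposition leaves the tails matched.\<close>
  have gx: "g x \<notin> set ys'"
    using Cons.prems(3) inj_image_mem_iff[OF permutes_inj[OF g(1)], of x "set xs"]
    by (simp flip: g(4))
  have "?t permutes (A \<union> B)" using A by (intro permutes_swap_id) auto
  then have "(?t \<circ> g) permutes (A \<union> B)" using g(1) by (rule permutes_compose[rotated])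
  moreover have "?t permutes A" using A by (intro permutes_swap_id) auto
  then have "(?t \<circ> g) ` A = A" using g(2) by (metis image_comp permutes_image)
  moreover have "?t b = b" if "b \<in> B" for b
    using that A Cons.prems(6) by (intro transpose_apply_other) auto
  then have "?t ` B = B" by simp
  then have "(?t \<circ> g) ` B = B" using g(3) by (metis image_comp)
  moreover have "map ?t ys' = ys'"
    using gx Cons.prems(4) ys by (intro map_idI transpose_apply_other) auto
  then have "map (?t \<circ> g) (x # xs) = ys" using g(4) ys by (simp flip: map_map)
  ultimately show ?case by (intro exI[of _ "?t \<circ> g"] conjI)
qed

text \<open>The consecutive pairs of edges of a path are exactly the two-edge paths it contains.\<close>

lemma card_two_edge_subpaths:
  assumes "distinct ws" and S: "\<And>us. us \<in> S \<Longrightarrow> distinct us \<and> length us = 3"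
    and rev: "\<And>us. us \<in> S \<Longrightarrow> rev us \<in> S"
  shows "card {T \<in> path_edges ` S. T \<subseteq> path_edges ws} =
    card {i. i + 2 < length ws \<and> [ws ! i, ws ! (i + 1), ws ! (i + 2)] \<in> S}"
proof -
  let ?t = "\<lambda>i. [ws ! i, ws ! (i + 1), ws ! (i + 2)]"
  let ?I = "{i. i + 2 < length ws \<and> ?t i \<in> S}"
  have "{T \<in> path_edges ` S. T \<subseteq> path_edges ws} = (\<lambda>i. path_edges (?t i)) ` ?I"
  proof (intro equalityI subsetI)
    fix T assume "T \<in> {T \<in> path_edges ` S. T \<subseteq> path_edges ws}"
    then obtain us where us: "us \<in> S" "T = path_edges us" "path_edges us \<subseteq> path_edges ws" by auto
    obtain a b c where abc: "us = [a, b, c]"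
      using S[OF us(1)] by (auto simp: numeral_3_eq_3 length_Suc_conv)
    \<comment> \<open>The middle vertex \<open>b\<close> has two distinct neighbours on the path, so
      it sits at an inner position \<open>j\<close>, and \<open>a\<close>, \<open>c\<close> are its
      two neighbours in one of the two orders.\<close>
    have ab: "{b, a} \<in> path_edges ws" "{b, c} \<in> path_edges ws" and ac: "a \<noteq> c"
      using us abc path_edges_3[of a b c] S[OF us(1)] by (auto simp: insert_commute)
    then obtain j where j: "j < length ws" "b = ws ! j"
      using vertex_of_path_edges[OF ab(1)] by blast
    have a: "(Suc j < length ws \<and> a = ws ! Suc j) \<or> (0 < j \<and> a = ws ! (j - 1))"
      and c: "(Suc j < length ws \<and> c = ws ! Suc j) \<or> (0 < j \<and> c = ws ! (j - 1))"
      using ab edge_in_path_edges_iff[OF assms(1) j(1)] j(2) by auto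
    have jb: "0 < j" "Suc j < length ws" using a c ac by auto
    then obtain i where i: "j = Suc i" by (cases j) auto
    have "us = ?t i \<or> us = rev (?t i)" using a c ac abc j i by auto
    then show "T \<in> (\<lambda>i. path_edges (?t i)) ` ?I"
    proof
      assume "us = ?t i"
      then show ?thesis using us i jb by auto
    next
      assume r: "us = rev (?t i)"
      then have "?t i = rev us" by simp
      then have "?t i \<in> S" "T = path_edges (?t i)" using rev[OF us(1)] us path_edges_rev[of us] by auto
      then show ?thesis using i jb by auto
    qed
  next
    fix T assume "T \<in> (\<lambda>i. path_edges (?t i)) ` ?I"
    then obtain i where i: "i + 2 < length ws" "?t i \<in> S" "T = path_edges (?t i)" by auto
    have "{ws ! i, ws ! Suc i} \<in> path_edges ws" "{ws ! Suc i, ws ! Suc (Suc i)} \<in> path_edges ws"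
      using i unfolding path_edges_def by force+
    then have "T \<subseteq> path_edges ws" using i(3) unfolding path_edges_3 by simp
    then show "T \<in> {T \<in> path_edges ` S. T \<subseteq> path_edges ws}" using i by blast
  qed
  \<comment> \<open>Equal edge sets force equality up to reversal, which keeps the middle vertex;
    the middle vertex in turn determines the position.\<close>
  moreover have "inj_on (\<lambda>i. path_edges (?t i)) ?I"
  proof (rule inj_onI)
    fix i j assume i: "i \<in> ?I" and j: "j \<in> ?I" and eq: "path_edges (?t i) = path_edges (?t j)"
    have "?t i = ?t j \<or> ?t i = rev (?t j)"
      using path_edges_eqD[OF _ _ _ _ eq] S[of "?t i"] S[of "?t j"] i j by simp
    then have "ws ! (i + 1) = ws ! (j + 1)" by auto
    then show "i = j" using assms(1) i j by (simp add: nth_eq_iff_index_eq)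
  qed
  ultimately show ?thesis by (simp add: card_image)
qed

lemma path_edges_no_star:
  assumes "distinct ws" "{x, y1} \<in> path_edges ws" "{x, y2} \<in> path_edges ws" "{x, y3} \<in> path_edges ws"
  shows "y1 = y2 \<or> y1 = y3 \<or> y2 = y3"
proof -
  obtain j where "j < length ws" "x = ws ! j"
    using vertex_of_path_edges[OF assms(2)] by blast
  then show ?thesis using assms edge_in_path_edges_iff[of ws j] by auto
qed

section \<open>Double counting and relabelling the points of a design\<close>

lemma two_mult_choose_two: "2 * (n choose 2) = n * (n - 1)"
  by (cases n) (simp_all add: choose_two)

text \<open>Both sides count the pairs of some \<open>T\<close> and some \<open>b\<close> with
  \<open>T \<subseteq> b\<close>.\<close>

lemma incidence_double_count:
  assumes "finite \<B>" "finite \<T>"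
    and "\<And>T. T \<in> \<T> \<Longrightarrow> card {b \<in> \<B>. T \<subseteq> b} = l"
    and "\<And>b. b \<in> \<B> \<Longrightarrow> card {T \<in> \<T>. T \<subseteq> b} = c"
  shows "l * card \<T> = c * card \<B>"
  using sum_multicount_gen[of \<B> \<T> "\<lambda>b T. T \<subseteq> b" "\<lambda>_. l"] assms by (simp add: mult.commute)

text \<open>An injective relabelling preserves sizes, inclusions and the number of blocks through a
  set. It serves to replace the points, which are ordered pairs, by the edges of the graph.\<close>

lemma is_design_image_iff:
  assumes inj: "inj_on f P" and sub: "\<And>b. b \<in> B \<Longrightarrow> b \<subseteq> P"
  shows "is_design t v k l (f ` P, (`) f ` B) \<longleftrightarrow> is_design t v k l (P, B)"
proof -
  have injB: "inj_on ((`) f) (Pow P)" using inj by (simp add: inj_on_image_Pow)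
  have card: "card (f ` X) = card X" if "X \<subseteq> P" for X
    using card_image inj inj_on_subset that by blast
  have count: "card {b \<in> (`) f ` B. f ` T \<subseteq> b} = card {b \<in> B. T \<subseteq> b}" if T: "T \<subseteq> P" for T
  proof -
    have "{b \<in> (`) f ` B. f ` T \<subseteq> b} = (`) f ` {b \<in> B. T \<subseteq> b}"
    proof -
      have "f ` T \<subseteq> f ` b \<longleftrightarrow> T \<subseteq> b" if "b \<in> B" for b
        using inj_on_image_mem_iff[OF inj _ sub[OF that]] T by blast
      then show ?thesis by auto
    qed
    moreover have "inj_on ((`) f) {b \<in> B. T \<subseteq> b}"
      using injB by (rule inj_on_subset) (use sub in auto)
    ultimately show ?thesis by (simp add: card_image)
  qed
  have points: "(\<forall>T. T \<subseteq> f ` P \<and> card T = t \<longrightarrow> card {b \<in> (`) f ` B. T \<subseteq> b} = l) \<longleftrightarrow>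
      (\<forall>T. T \<subseteq> P \<and> card T = t \<longrightarrow> card {b \<in> B. T \<subseteq> b} = l)"
    (is "?L \<longleftrightarrow> ?R")
  proof (intro iffI allI impI)
    fix T assume L: ?L and T: "T \<subseteq> P \<and> card T = t"
    have "f ` T \<subseteq> f ` P \<and> card (f ` T) = t" using card[of T] T by (simp add: image_mono)
    then have "card {b \<in> (`) f ` B. f ` T \<subseteq> b} = l" using L by blast
    then show "card {b \<in> B. T \<subseteq> b} = l" using count[of T] T by simp
  next
    fix T' assume R: ?R and T': "T' \<subseteq> f ` P \<and> card T' = t"
    then obtain T where T: "T \<subseteq> P" "T' = f ` T" by (meson subset_imageE)
    then have "card T = t" using T' card by simp
    then show "card {b \<in> (`) f ` B. T' \<subseteq> b} = l" using R T count[OF T(1)] by blast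
  qed
  have blocks: "(\<forall>b\<in>(`) f ` B. b \<subseteq> f ` P \<and> card b = k) \<longleftrightarrow> (\<forall>b\<in>B. b \<subseteq> P \<and> card b = k)"
  proof -
    have "f ` b \<subseteq> f ` P \<and> card (f ` b) = k \<longleftrightarrow> b \<subseteq> P \<and> card b = k" if "b \<in> B" for b
      using sub[OF that] card[OF sub[OF that]] by (simp add: image_mono)
    then show ?thesis by (simp cong: ball_cong)
  qed
  show ?thesis unfolding is_design_def fst_conv snd_conv points blocks card[OF subset_refl] ..
qed

section \<open>Copies of a path in the complete bipartite graph\<close>

text \<open>The map \<open>\<tau>\<close> exchanges the parts; finiteness and size of
  \<open>W\<close> are obtained from those of \<open>V\<close> through it.\<close>

locale complete_bipartite =
  fixes V W :: "'a set" and m :: nat and \<tau> :: "'a \<Rightarrow> 'a"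
  assumes finite_V: "finite V" and card_V: "card V = m" and disjoint: "V \<inter> W = {}"
    and swap: "\<tau> permutes (V \<union> W)" "\<tau> ` V = W" "\<tau> ` W = V"
begin

definition edges :: "'a set set" where
  "edges = {{x, y} | x y. x \<in> V \<and> y \<in> W}"

text \<open>Admitting both starting parts makes the set closed under reversal and under exchange of
  the parts.\<close>

definition paths :: "nat \<Rightarrow> 'a list set" where
  "paths n = alt_lists V W n \<union> alt_lists W V n"

definition path_copies :: "nat \<Rightarrow> 'a set set set" where
  "path_copies k = path_edges ` paths (k + 1)"

text \<open>These are the automorphisms of the complete bipartite graph, extended by the identity to
  all other vertices.\<close>

definition automorphism :: "('a \<Rightarrow> 'a) \<Rightarrow> bool" where
  "automorphism g \<longleftrightarrow> g permutes (V \<union> W) \<and> (g ` V = V \<and> g ` W = W \<or> g ` V = W \<and> g ` W = V)"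

lemma finite_W: "finite W" and card_W: "card W = m"
proof -
  show "finite W" using swap(2) finite_V by auto
  have "inj_on \<tau> V" using permutes_inj[OF swap(1)] by (rule inj_on_subset) simp
  then show "card W = m" using card_image[of \<tau> V] swap(2) card_V by simp
qed

lemma edges_image: "edges = (\<lambda>(x, y). {x, y}) ` (V \<times> W)"
  by (auto simp: edges_def)

lemma inj_on_pair_edge: "inj_on (\<lambda>(x, y). {x, y}) (V \<times> W)"
  using disjoint by (auto simp: inj_on_def doubleton_eq_iff)

lemma card_edges: "card edges = m\<^sup>2"
  by (simp add: edges_image card_image[OF inj_on_pair_edge] card_cartesian_product card_V card_W power2_eq_square)

lemma finite_edges: "finite edges"
  using finite_V finite_W by (simp add: edges_image)

lemma finite_paths: "finite (paths n)"
  using finite_alt_lists finite_V finite_W by (auto simp: paths_def)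

lemma pathsD:
  assumes "ws \<in> paths n"
  shows "distinct ws" "length ws = n" "set ws \<subseteq> V \<union> W"
  using assms alternating_set[of V W ws] alternating_set[of W V ws]
  by (auto simp: paths_def alt_lists_def)

lemma rev_paths: "ws \<in> paths n \<Longrightarrow> rev ws \<in> paths n"
  using alternating_rev[of V W ws] alternating_rev[of W V ws]
  by (auto simp: paths_def alt_lists_def split: if_splits)

section \<open>The number of copies of a path\<close>

lemma alt_lists_disjoint: "0 < n \<Longrightarrow> alt_lists V W n \<inter> alt_lists W V n = {}"
  using disjoint by (auto simp: alt_lists_def alternating_iff_nth)

lemma card_alt_lists_VW:
  "card (alt_lists V W n) = (\<Prod>i<n. m - i div 2)" "card (alt_lists W V n) = (\<Prod>i<n. m - i div 2)"
  using card_alt_lists[of V W m n] card_alt_lists[of W V m n] finite_V finite_W card_V card_W disjoint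
  by (simp_all add: Int_commute)

text \<open>The choice of the starting part doubles the number of lists, and identifying a list with
  its reversal halves it again.\<close>

lemma card_path_copies:
  assumes "0 < k"
  shows "card (path_copies k) = (\<Prod>i<k+1. m - i div 2)"
proof -
  have "card (paths (k + 1)) = 2 * (\<Prod>i<k+1. m - i div 2)"
    unfolding paths_def using alt_lists_disjoint[of "k + 1"]
    by (subst card_Un_disjoint)
      (simp_all add: finite_alt_lists finite_V finite_W card_alt_lists_VW del: prod.lessThan_Suc)
  moreover have "card (paths (k + 1)) = 2 * card (path_edges ` paths (k + 1))"
    by (rule card_path_edges_image[of _ "k + 1"]) (use pathsD rev_paths finite_paths assms in auto)
  ultimately show ?thesis by (simp add: path_copies_def)
qed

lemma card_path_copies_2: "card (path_copies 2) = m * m * (m - 1)"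
  by (simp add: card_path_copies numeral_3_eq_3)

lemma finite_path_copies: "finite (path_copies k)"
  by (simp add: path_copies_def finite_paths)

lemma path_edges_subset:
  assumes "ws \<in> paths n"
  shows "path_edges ws \<subseteq> edges"
proof
  fix e assume "e \<in> path_edges ws"
  then obtain i where i: "Suc i < length ws" "e = {ws ! i, ws ! Suc i}"
    by (auto simp: path_edges_def)
  have "(\<forall>i<length ws. ws ! i \<in> (if even i then V else W)) \<or>
      (\<forall>i<length ws. ws ! i \<in> (if even i then W else V))"
    using assms by (auto simp: paths_def alt_lists_def alternating_iff_nth)
  then have "ws ! i \<in> V \<and> ws ! Suc i \<in> W \<or> ws ! i \<in> W \<and> ws ! Suc i \<in> V"
    using i(1) by (cases "even i") (auto dest: Suc_lessD)
  then show "e \<in> edges" using i(2) by (auto simp: edges_def)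
qed

lemma path_copies_subset: "b \<in> path_copies k \<Longrightarrow> b \<subseteq> edges"
  using path_edges_subset by (auto simp: path_copies_def)

lemma path_copies_card: "b \<in> path_copies k \<Longrightarrow> card b = k"
  by (auto simp: path_copies_def card_path_edges pathsD)

lemma consecutive_in_paths:
  assumes ws: "ws \<in> paths n" "i + 2 < n"
  shows "[ws ! i, ws ! (i + 1), ws ! (i + 2)] \<in> paths 3"
proof -
  have d: "distinct [ws ! i, ws ! (i + 1), ws ! (i + 2)]"
    using pathsD(1,2)[OF ws(1)] ws(2) by (simp add: nth_eq_iff_index_eq)
  have "(\<forall>i<length ws. ws ! i \<in> (if even i then V else W)) \<or>
      (\<forall>i<length ws. ws ! i \<in> (if even i then W else V))"
    using ws by (auto simp: paths_def alt_lists_def alternating_iff_nth)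
  moreover have "i < length ws" "i + 1 < length ws" "i + 2 < length ws"
    using pathsD(2)[OF ws(1)] ws(2) by auto
  ultimately have
    "ws ! i \<in> (if even i then V else W) \<and> ws ! (i + 1) \<in> (if even (i + 1) then V else W) \<and>
      ws ! (i + 2) \<in> (if even (i + 2) then V else W) \<or>
     ws ! i \<in> (if even i then W else V) \<and> ws ! (i + 1) \<in> (if even (i + 1) then W else V) \<and>
      ws ! (i + 2) \<in> (if even (i + 2) then W else V)"
    by blast
  then show ?thesis using d by (cases "even i") (auto simp: paths_def alt_lists_def)
qed

text \<open>The \<open>k + 1\<close> vertices of a copy include \<open>k - 1\<close> inner ones, and
  each is the centre of exactly one adjacent pair.\<close>

lemma card_adjacent_pairs_in_copy:
  assumes "b \<in> path_copies k"
  shows "card {T \<in> path_copies 2. T \<subseteq> b} = k - 1"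
proof -
  obtain ws where ws: "ws \<in> paths (k + 1)" "b = path_edges ws"
    using assms by (auto simp: path_copies_def)
  have "card {T \<in> path_edges ` paths 3. T \<subseteq> path_edges ws} =
    card {i. i + 2 < length ws \<and> [ws ! i, ws ! (i + 1), ws ! (i + 2)] \<in> paths 3}"
    by (rule card_two_edge_subpaths) (use pathsD rev_paths ws in blast)+
  also have "{i. i + 2 < length ws \<and> [ws ! i, ws ! (i + 1), ws ! (i + 2)] \<in> paths 3} = {..<k - 1}"
    using consecutive_in_paths[OF ws(1)] pathsD(2)[OF ws(1)] by auto
  finally show ?thesis using ws by (simp add: path_copies_def)
qed

section \<open>Transitivity of the automorphisms on paths\<close>

lemma automorphism_paths:
  assumes "automorphism g" "ws \<in> paths n"
  shows "map g ws \<in> paths n"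
proof -
  have "inj g" using assms(1) permutes_inj by (auto simp: automorphism_def)
  then have "distinct (map g ws)" using pathsD[OF assms(2)] by (simp add: distinct_map inj_on_subset)
  moreover have "alternating V W (map g ws) \<or> alternating W V (map g ws)"
    using assms alternating_map[of V W ws g] alternating_map[of W V ws g]
    unfolding paths_def alt_lists_def automorphism_def by (elim conjE disjE UnE CollectE) simp_all
  moreover have "length (map g ws) = n" using pathsD(2)[OF assms(2)] by simp
  ultimately show ?thesis unfolding paths_def alt_lists_def by blast
qed

lemma ex_automorphism_map:
  assumes "us \<in> paths n" "ws \<in> paths n"
  shows "\<exists>g. automorphism g \<and> map g us = ws"
proof -
  have same: "\<exists>g. automorphism g \<and> g ` V = V \<and> g ` W = W \<and> map g us = ws"
    if "us \<in> alt_lists V W n \<and> ws \<in> alt_lists V W n \<or> us \<in> alt_lists W V n \<and> ws \<in> alt_lists W V n"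
    for us ws
    using that
  proof
    assume "us \<in> alt_lists V W n \<and> ws \<in> alt_lists V W n"
    then obtain g where "g permutes (V \<union> W)" "g ` V = V" "g ` W = W" "map g us = ws"
      using ex_permutes_map_alternating[of V W us ws] disjoint by (auto simp: alt_lists_def)
    then show ?thesis by (intro exI[of _ g]) (simp add: automorphism_def)
  next
    assume "us \<in> alt_lists W V n \<and> ws \<in> alt_lists W V n"
    then obtain g where "g permutes (W \<union> V)" "g ` V = V" "g ` W = W" "map g us = ws"
      using ex_permutes_map_alternating[of W V us ws] disjoint by (auto simp: alt_lists_def Int_commute)
    then show ?thesis by (intro exI[of _ g]) (simp add: automorphism_def Un_commute)
  qed
  have sw: "automorphism \<tau>" using swap by (simp add: automorphism_def)
  have ms: "map \<tau> us \<in> alt_lists W V n" if "us \<in> alt_lists V W n"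
    using that alternating_map[of V W us \<tau>] swap permutes_inj[OF swap(1)]
    by (simp add: alt_lists_def distinct_map inj_on_subset[of \<tau> UNIV])
  have ms': "map \<tau> us \<in> alt_lists V W n" if "us \<in> alt_lists W V n"
    using that alternating_map[of W V us \<tau>] swap permutes_inj[OF swap(1)]
    by (simp add: alt_lists_def distinct_map inj_on_subset[of \<tau> UNIV])
  \<comment> \<open>If the two lists start in different parts, applying \<open>\<tau>\<close> to the
    first one makes the starting parts agree.\<close>
  consider "us \<in> alt_lists V W n \<and> ws \<in> alt_lists V W n \<or> us \<in> alt_lists W V n \<and> ws \<in> alt_lists W V n"
    | "map \<tau> us \<in> alt_lists V W n \<and> ws \<in> alt_lists V W n \<or> map \<tau> us \<in> alt_lists W V n \<and> ws \<in> alt_lists W V n"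
    using assms ms ms' unfolding paths_def by blast
  then show ?thesis
  proof cases
    case 1
    then show ?thesis using same by blast
  next
    case 2
    then obtain g where g: "automorphism g" "g ` V = V" "g ` W = W" "map g (map \<tau> us) = ws"
      using same by blast
    have "(g \<circ> \<tau>) permutes (V \<union> W)" using swap(1) g(1) permutes_compose by (auto simp: automorphism_def)
    moreover have "(g \<circ> \<tau>) ` V = W" "(g \<circ> \<tau>) ` W = V" using g swap by (metis image_comp)+
    ultimately have "automorphism (g \<circ> \<tau>)" by (simp add: automorphism_def)
    then show ?thesis using g(4) by (intro exI[of _ "g \<circ> \<tau>"]) simp
  qed
qed

text \<open>Here \<open>F\<close> reads a set of edges off a vertex list compatibly with
  relabelling. Taking \<open>path_edges\<close> on three vertices gives adjacent pairs; taking the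
  first and last edge on four vertices gives disjoint pairs.\<close>

lemma card_copies_containing_cong:
  assumes "us \<in> paths n" "ws \<in> paths n"
    and F: "\<And>g xs. length xs = n \<Longrightarrow> F (map g xs) = (`) g ` F xs"
  shows "card {b \<in> path_copies k. F us \<subseteq> b} = card {b \<in> path_copies k. F ws \<subseteq> b}"
proof -
  \<comment> \<open>An automorphism from \<open>us\<close> to \<open>ws\<close> maps the copies
    through \<open>F us\<close> injectively to copies through \<open>F ws\<close>; exchanging the
    roles of \<open>us\<close> and \<open>ws\<close> gives equality.\<close>
  have le: "card {b \<in> path_copies k. F us \<subseteq> b} \<le> card {b \<in> path_copies k. F ws \<subseteq> b}"
    if "us \<in> paths n" "ws \<in> paths n" for us ws
  proof -
    obtain g where g: "automorphism g" "map g us = ws" using ex_automorphism_map \<open>us \<in> _\<close> \<open>ws \<in> _\<close> by blast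
    have "inj g" using g(1) permutes_inj by (auto simp: automorphism_def)
    then have "inj ((`) g)" by (simp add: inj_def[of "(`) g"] inj_image_eq_iff)
    then have "inj ((`) ((`) g))" by (simp add: inj_def[of "(`) ((`) g)"] inj_image_eq_iff)
    then have "inj_on ((`) ((`) g)) {b \<in> path_copies k. F us \<subseteq> b}"
      by (rule inj_on_subset) simp
    moreover have "(`) ((`) g) ` {b \<in> path_copies k. F us \<subseteq> b} \<subseteq> {b \<in> path_copies k. F ws \<subseteq> b}"
    proof clarsimp
      fix b assume b: "b \<in> path_copies k" "F us \<subseteq> b"
      have "(`) g ` b \<in> path_copies k"
        using b(1) automorphism_paths[OF g(1)] by (auto simp: path_copies_def simp flip: path_edges_map)
      moreover have "F ws \<subseteq> (`) g ` b"
        using F[of us g] g(2) pathsD(2)[OF that(1)] b(2) by auto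
      ultimately show "(`) g ` b \<in> path_copies k \<and> F ws \<subseteq> (`) g ` b" ..
    qed
    ultimately show ?thesis by (rule card_inj_on_le) (simp add: finite_path_copies)
  qed
  show ?thesis using le[OF assms(1,2)] le[OF assms(2,1)] by simp
qed

text \<open>Two edges with a common end would form a two-edge path, so these are disjoint and are
  the outer edges of a path on four vertices. In this form transitivity on paths applies to
  them.\<close>

lemma pair_of_edges_cases:
  assumes "T \<subseteq> edges" "card T = 2" "T \<notin> path_copies 2"
  shows "\<exists>us \<in> paths 4. T = {{us ! 0, us ! 1}, {us ! 2, us ! 3}}"
proof -
  obtain e f where ef: "T = {e, f}" "e \<noteq> f" using assms(2) by (auto simp: card_2_iff)
  obtain x y where e: "e = {x, y}" "x \<in> V" "y \<in> W" using ef assms(1) by (auto simp: edges_def)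
  obtain x' y' where f: "f = {x', y'}" "x' \<in> V" "y' \<in> W" using ef assms(1) by (auto simp: edges_def)
  have ne: "x \<noteq> y" "x \<noteq> y'" "x' \<noteq> y" "x' \<noteq> y'" using e f disjoint by auto
  have "x \<noteq> x'"
  proof
    assume "x = x'"
    then have "[y, x, y'] \<in> paths 3" using e f ef ne by (auto simp: paths_def alt_lists_def)
    moreover have "T = path_edges [y, x, y']" using \<open>x = x'\<close> e f ef by (auto simp: path_edges_3 insert_commute)
    ultimately show False using assms(3) by (auto simp: path_copies_def)
  qed
  moreover have "y \<noteq> y'"
  proof
    assume "y = y'"
    then have "[x, y, x'] \<in> paths 3" using e f ef ne by (auto simp: paths_def alt_lists_def)
    moreover have "T = path_edges [x, y, x']" using \<open>y = y'\<close> e f ef by (auto simp: path_edges_3 insert_commute)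
    ultimately show False using assms(3) by (auto simp: path_copies_def)
  qed
  ultimately have "[x, y, x', y'] \<in> paths 4" using e f ne by (auto simp: paths_def alt_lists_def)
  then show ?thesis using e f ef by (intro bexI[of _ "[x, y, x', y']"]) auto
qed

lemma count_adjacent_pairs:
  assumes "\<And>T. T \<in> path_copies 2 \<Longrightarrow> card {b \<in> path_copies k. T \<subseteq> b} = l"
  shows "l * (m * m * (m - 1)) = (k - 1) * card (path_copies k)"
proof -
  have "l * card (path_copies 2) = (k - 1) * card (path_copies k)"
    by (rule incidence_double_count)
      (auto simp: finite_path_copies assms card_adjacent_pairs_in_copy)
  then show ?thesis by (simp add: card_path_copies_2)
qed

section \<open>Pairs of edges and the condition for a two-design\<close>

lemma card_pairs_in_copy:
  assumes "b \<in> path_copies k"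
  shows "card {T. T \<subseteq> b \<and> card T = 2} = k choose 2"
  using n_subsets[of b 2] path_copies_card[OF assms] path_copies_subset[OF assms] finite_edges finite_subset
  by metis

lemma path_copies_2_subset: "path_copies 2 \<subseteq> {T. T \<subseteq> edges \<and> card T = 2}"
  using path_copies_subset path_copies_card by auto

lemma finite_pairs: "finite {T. T \<subseteq> edges \<and> card T = 2}"
  by (rule finite_subset[of _ "Pow edges"]) (auto simp: finite_edges)

text \<open>Adjacent pairs and all pairs are counted with the same \<open>l\<close>. Eliminating the
  number of copies between the two equations leaves \<open>m + 1 = k\<close>.\<close>

lemma two_design_order:
  assumes "is_design 2 v k' l (edges, path_copies k)" "2 \<le> m" "2 \<le> k" "0 < card (path_copies k)"
  shows "m = k - 1"
proof -
  let ?b = "card (path_copies k)"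
  have T: "card {b \<in> path_copies k. T \<subseteq> b} = l" if "T \<subseteq> edges" "card T = 2" for T
    using assms(1) that by (auto simp: is_design_def)
  have l: "0 < l" using assms(1) by (auto simp: is_design_def)
  have "l * (m * m * (m - 1)) = (k - 1) * ?b"
    by (rule count_adjacent_pairs) (use T path_copies_2_subset in auto)
  moreover have "l * card {T. T \<subseteq> edges \<and> card T = 2} = (k choose 2) * ?b"
  proof (rule incidence_double_count[OF finite_path_copies finite_pairs])
    fix b assume b: "b \<in> path_copies k"
    then have "{T \<in> {T. T \<subseteq> edges \<and> card T = 2}. T \<subseteq> b} = {T. T \<subseteq> b \<and> card T = 2}"
      using path_copies_subset by blast
    then show "card {T \<in> {T. T \<subseteq> edges \<and> card T = 2}. T \<subseteq> b} = k choose 2"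
      using card_pairs_in_copy[OF b] by simp
  qed (use T in auto)
  then have "l * (m\<^sup>2 choose 2) = (k choose 2) * ?b"
    using n_subsets[OF finite_edges, of 2] card_edges by simp
  then have "l * (2 * (m\<^sup>2 choose 2)) = 2 * (k choose 2) * ?b" by simp
  then have "l * (m\<^sup>2 * (m\<^sup>2 - 1)) = k * (k - 1) * ?b" unfolding two_mult_choose_two .
  ultimately have "l * (m\<^sup>2 * (m\<^sup>2 - 1)) = k * (l * (m * m * (m - 1)))" by simp
  \<comment> \<open>This exposes the factor \<open>m - 1\<close> that both counts share; it is
    cancelled together with \<open>l * m * m\<close>, which is positive.\<close>
  moreover have "m\<^sup>2 - 1 = (m + 1) * (m - 1)"
    using assms(2) by (simp add: power2_eq_square algebra_simps diff_mult_distrib2)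
  ultimately have "(l * m * m * (m - 1)) * (m + 1) = (l * m * m * (m - 1)) * k"
    by (simp add: power2_eq_square ac_simps)
  moreover have "0 < l * m * m * (m - 1)" using l assms(2) by simp
  ultimately have "m + 1 = k" by (metis mult_cancel1 less_irrefl)
  then show ?thesis by simp
qed

text \<open>Transitivity gives one count \<open>l\<close> for all adjacent pairs and one count
  \<open>l'\<close> for all disjoint pairs. Double counting each type separately yields the same
  value when \<open>m = k - 1\<close>.\<close>

lemma two_design:
  assumes mk: "m = k - 1" and "3 \<le> k" "0 < card (path_copies k)"
  shows "\<exists>l. l * (m * (m - 1)) = card (path_copies k) \<and> is_design 2 (m\<^sup>2) k l (edges, path_copies k)"
proof -
  let ?b = "card (path_copies k)"
  let ?n = "\<lambda>T. card {b \<in> path_copies k. T \<subseteq> b}"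
  let ?D = "{T. T \<subseteq> edges \<and> card T = 2} - path_copies 2"
  have "\<exists>l. \<forall>T\<in>path_copies 2. ?n T = l"
  proof -
    have eq: "?n T = ?n T'" if "T \<in> path_copies 2" "T' \<in> path_copies 2" for T T'
    proof -
      from that obtain us ws where p: "us \<in> paths (2 + 1)" "ws \<in> paths (2 + 1)"
        and T: "T = path_edges us" "T' = path_edges ws"
        by (auto simp: path_copies_def)
      show ?thesis unfolding T by (rule card_copies_containing_cong[OF p path_edges_map])
    qed
    then show ?thesis by (intro exI[of _ "?n (SOME T. T \<in> path_copies 2)"] ballI eq) (assumption, rule someI)
  qed
  then obtain l where l: "\<And>T. T \<in> path_copies 2 \<Longrightarrow> ?n T = l" by blast
  have "\<exists>l'. \<forall>T\<in>?D. ?n T = l'"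
  proof -
    have F: "?n {{us ! 0, us ! 1}, {us ! 2, us ! 3}} = ?n {{ws ! 0, ws ! 1}, {ws ! 2, ws ! 3}}"
      if "us \<in> paths 4" "ws \<in> paths 4" for us ws
      using that by (rule card_copies_containing_cong) simp
    have eq: "?n T = ?n T'" if "T \<in> ?D" "T' \<in> ?D" for T T'
    proof -
      from that obtain us ws where p: "us \<in> paths 4" "ws \<in> paths 4"
        and T: "T = {{us ! 0, us ! 1}, {us ! 2, us ! 3}}" "T' = {{ws ! 0, ws ! 1}, {ws ! 2, ws ! 3}}"
        using pair_of_edges_cases[of T] pair_of_edges_cases[of T'] by blast
      show ?thesis unfolding T by (rule F[OF p])
    qed
    then show ?thesis by (intro exI[of _ "?n (SOME T. T \<in> ?D)"] ballI eq) (assumption, rule someI)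
  qed
  then obtain l' where l': "\<And>T. T \<in> ?D \<Longrightarrow> ?n T = l'" by blast
  have a: "l * (m * m * (m - 1)) = m * ?b"
    using count_adjacent_pairs[OF l] mk by simp
  have b: "l * (m * (m - 1)) = ?b" using a assms by (simp add: ac_simps)
  \<comment> \<open>A copy contains \<open>k choose 2\<close> pairs of edges, of which
    \<open>k - 1\<close> are adjacent and all others disjoint.\<close>
  have "l' * card ?D = ((k choose 2) - (k - 1)) * ?b"
  proof (rule incidence_double_count[OF finite_path_copies])
    fix b assume b: "b \<in> path_copies k"
    have "{T \<in> ?D. T \<subseteq> b} = {T. T \<subseteq> b \<and> card T = 2} - {T \<in> path_copies 2. T \<subseteq> b}"
      using path_copies_subset[OF b] by blast
    moreover have "{T \<in> path_copies 2. T \<subseteq> b} \<subseteq> {T. T \<subseteq> b \<and> card T = 2}"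
      using path_copies_card by auto
    ultimately show "card {T \<in> ?D. T \<subseteq> b} = (k choose 2) - (k - 1)"
      using card_pairs_in_copy[OF b] card_adjacent_pairs_in_copy[OF b] finite_path_copies
      by (simp add: card_Diff_subset)
  qed (use l' finite_pairs in auto)
  moreover have "card ?D = (m\<^sup>2 choose 2) - m * m * (m - 1)"
    using n_subsets[OF finite_edges, of 2] card_edges path_copies_2_subset
    by (simp add: card_Diff_subset finite_path_copies card_path_copies_2)
  ultimately have "l' * ((m\<^sup>2 choose 2) - m * m * (m - 1)) = ((k choose 2) - (k - 1)) * ?b" by simp
  then have "l' * (2 * (m\<^sup>2 choose 2) - 2 * (m * m * (m - 1))) = (2 * (k choose 2) - 2 * (k - 1)) * ?b"
    by (simp flip: diff_mult_distrib2)
  then have "l' * (m\<^sup>2 * (m\<^sup>2 - 1) - 2 * (m * m * (m - 1))) = (k * (k - 1) - 2 * (k - 1)) * ?b"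
    unfolding two_mult_choose_two .
  \<comment> \<open>Writing \<open>m = n + 2\<close> and \<open>k = n + 3\<close> removes the
    truncated subtractions. Twice the number of disjoint pairs is then the square of
    \<open>m * (m - 1)\<close> in the graph and \<open>m * (m - 1)\<close> in a copy.\<close>
  moreover obtain n where n: "m = n + 2" "k = n + 3"
    using assms by (metis add_diff_cancel_right' le_Suc_ex add.commute diff_add_inverse eval_nat_numeral(3) add_Suc_right diff_Suc_1)
  moreover have "(n + 2)\<^sup>2 * ((n + 2)\<^sup>2 - 1) - 2 * ((n + 2) * (n + 2) * (n + 2 - 1)) = (n + 2) * (n + 2) * (n + 1) * (n + 1)"
    by (simp add: power2_eq_square algebra_simps)
  moreover have "(n + 3) * (n + 3 - 1) - 2 * (n + 3 - 1) = (n + 2) * (n + 1)"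
    by (simp add: algebra_simps)
  ultimately have "l' * ((n + 2) * (n + 2) * (n + 1) * (n + 1)) = (n + 2) * (n + 1) * ?b" by simp
  then have "((n + 2) * (n + 1)) * (l' * ((n + 2) * (n + 1))) = ((n + 2) * (n + 1)) * ?b"
    by (simp only: ac_simps)
  then have "l' * ((n + 2) * (n + 1)) = ?b" unfolding mult_cancel1 by simp
  then have "l' * ((n + 2) * (n + 1)) = l * ((n + 2) * (n + 1))" using b n by simp
  then have ll: "l' = l" unfolding mult_cancel2 by simp
  have "?n T = l" if "T \<subseteq> edges" "card T = 2" for T
    using l[of T] l'[of T] ll that by blast
  moreover have "0 < l" using b assms(3) by (cases l) auto
  ultimately have "is_design 2 (m\<^sup>2) k l (edges, path_copies k)"
    using card_edges path_copies_card path_copies_subset assms n by (auto simp: is_design_def)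
  then show ?thesis using b by blast
qed

text \<open>Since \<open>l\<close> is positive, some copy would contain three edges at a common
  vertex; \<open>3 \<le> m\<close> supplies such a star.\<close>

lemma not_three_design:
  assumes "3 \<le> m"
  shows "\<not> is_t_design 3 (edges, path_copies k)"
proof
  assume "is_t_design 3 (edges, path_copies k)"
  then obtain v k' l where "is_design 3 v k' l (edges, path_copies k)" by (auto simp: is_t_design_def)
  then have l: "0 < l" and D: "\<And>T. T \<subseteq> edges \<Longrightarrow> card T = 3 \<Longrightarrow> card {b \<in> path_copies k. T \<subseteq> b} = l"
    by (auto simp: is_design_def)
  obtain Y where Y: "Y \<subseteq> W" "card Y = 3" using assms card_W obtain_subset_with_card_n by metis
  then obtain y1 y2 y3 where y: "Y = {y1, y2, y3}" "y1 \<noteq> y2" "y1 \<noteq> y3" "y2 \<noteq> y3"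
    by (auto simp: card_3_iff)
  obtain x where x: "x \<in> V" using assms card_V by fastforce
  let ?T = "{{x, y1}, {x, y2}, {x, y3}}"
  have "?T \<subseteq> edges" using x y Y by (auto simp: edges_def)
  moreover have "card ?T = 3" using y by (auto simp: card_insert_if doubleton_eq_iff)
  ultimately have "{b \<in> path_copies k. ?T \<subseteq> b} \<noteq> {}" using D l by (metis card.empty less_irrefl)
  then obtain ws where "ws \<in> paths (k + 1)" "?T \<subseteq> path_edges ws" by (auto simp: path_copies_def)
  then show False using path_edges_no_star[of ws x y1 y2 y3] pathsD(1) y by auto
qed

text \<open>The path has \<open>k div 2\<close> inner vertices in \<open>W\<close> but only \<open>k div 2 - 1\<close> in \<open>V\<close>,
  while the complete graph has equally many two-edge paths of both types.\<close>

lemma one_sided_not_two_design: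
  assumes "even k" "0 < k" "2 \<le> m"
  shows "\<not> is_t_design 2 (edges, path_edges ` alt_lists V W (k + 1))"
proof
  let ?B = "path_edges ` alt_lists V W (k + 1)"
  assume "is_t_design 2 (edges, ?B)"
  then obtain v k' l where "is_design 2 v k' l (edges, ?B)" by (auto simp: is_t_design_def)
  then have l: "0 < l" and D: "\<And>T. T \<subseteq> edges \<Longrightarrow> card T = 2 \<Longrightarrow> card {b \<in> ?B. T \<subseteq> b} = l"
    by (auto simp: is_design_def)
  have sub: "alt_lists V W n \<subseteq> paths n" "alt_lists W V n \<subseteq> paths n" for n by (auto simp: paths_def)
  have fin: "finite (alt_lists V W n)" "finite (alt_lists W V n)" for n
    using finite_alt_lists finite_V finite_W by auto
  \<comment> \<open>The Boolean \<open>Q\<close> selects the type of two-edge path: ends in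
    \<open>V\<close> and centre in \<open>W\<close> if true, the opposite if false. Along a list
    starting in \<open>V\<close>, the first type begins at even positions and the second at odd
    ones.\<close>
  have count: "l * card (path_edges ` S) = card {i. i < k - 1 \<and> (even i \<longleftrightarrow> Q)} * card ?B"
    if S: "S = alt_lists V W 3 \<and> Q \<or> S = alt_lists W V 3 \<and> \<not> Q" for S and Q :: bool
  proof (rule incidence_double_count)
    show "finite ?B" "finite (path_edges ` S)" using fin S by auto
    have SP: "S \<subseteq> paths 3" using S sub by auto
    show "card {b \<in> ?B. T \<subseteq> b} = l" if T: "T \<in> path_edges ` S" for T
    proof (rule D)
      have "T \<in> path_copies 2" using T SP by (auto simp: path_copies_def)
      then show "T \<subseteq> edges" "card T = 2" using path_copies_2_subset by auto
    qed
    fix b assume "b \<in> ?B"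
    then obtain ws where ws: "ws \<in> alt_lists V W (k + 1)" "b = path_edges ws" by blast
    then have wp: "ws \<in> paths (k + 1)" using sub by auto
    have revS: "rev us \<in> S" if "us \<in> S" for us
      using S that alternating_rev[of V W us] alternating_rev[of W V us] by (auto simp: alt_lists_def)
    have "card {T \<in> path_edges ` S. T \<subseteq> path_edges ws} =
      card {i. i + 2 < length ws \<and> [ws ! i, ws ! (i + 1), ws ! (i + 2)] \<in> S}"
      by (rule card_two_edge_subpaths) (use pathsD SP revS wp in blast)+
    also have "{i. i + 2 < length ws \<and> [ws ! i, ws ! (i + 1), ws ! (i + 2)] \<in> S} =
      {i. i < k - 1 \<and> (even i \<longleftrightarrow> Q)}"
    proof -
      have "[ws ! i, ws ! (i + 1), ws ! (i + 2)] \<in> S \<longleftrightarrow> (even i \<longleftrightarrow> Q)" if i: "i + 2 < k + 1" for i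
      proof -
        have p: "[ws ! i, ws ! (i + 1), ws ! (i + 2)] \<in> paths 3"
          using consecutive_in_paths[OF wp i] .
        have "ws ! i \<in> (if even i then V else W)"
          using ws(1) i by (auto simp: alt_lists_def alternating_iff_nth)
        then show ?thesis using p S disjoint by (cases "even i") (auto simp: paths_def alt_lists_def)
      qed
      moreover have "length ws = k + 1" using pathsD(2)[OF wp] .
      ultimately show ?thesis by auto
    qed
    finally show "card {T \<in> path_edges ` S. T \<subseteq> b} = card {i. i < k - 1 \<and> (even i \<longleftrightarrow> Q)}"
      using ws by simp
  qed
  have dbl: "card S = 2 * card (path_edges ` S)" if S: "S = alt_lists V W 3 \<or> S = alt_lists W V 3" for S
  proof (rule card_path_edges_image[of _ 3])
    show "rev us \<in> S" if "us \<in> S" for us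
      using S that alternating_rev[of V W us] alternating_rev[of W V us] by (auto simp: alt_lists_def)
  qed (use S fin in \<open>auto simp: alt_lists_def\<close>)
  have c: "card (alt_lists V W 3) = m * m * (m - 1)" "card (alt_lists W V 3) = m * m * (m - 1)"
    by (simp_all add: card_alt_lists_VW numeral_3_eq_3)
  then have cp: "card (path_edges ` alt_lists V W 3) = card (path_edges ` alt_lists W V 3)"
    using dbl[of "alt_lists V W 3"] dbl[of "alt_lists W V 3"] by simp
  have "0 < card (alt_lists V W 3)" unfolding c using assms(3) by simp
  then have pos: "0 < card (path_edges ` alt_lists V W 3)"
    using dbl[OF disjI1[OF refl]] by linarith
  obtain i where "k = 2 * i" using assms(1) by (elim evenE)
  then obtain j where j: "k - 1 = 2 * j + 1" using assms(2) by (intro that[of "i - 1"]) simp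
  \<comment> \<open>Of the \<open>2 * j + 1\<close> starting positions, one more is even than
    odd.\<close>
  have ev: "card {i. i < 2 * j + 1 \<and> even i} = j + 1" "card {i. i < 2 * j + 1 \<and> odd i} = j"
  proof -
    have "{i. i < 2 * j + 1 \<and> even i} = (\<lambda>i. 2 * i) ` {..<j + 1}" by (auto elim!: evenE)
    then show "card {i. i < 2 * j + 1 \<and> even i} = j + 1" by (simp add: card_image inj_on_def)
    have "{i. i < 2 * j + 1 \<and> odd i} = (\<lambda>i. 2 * i + 1) ` {..<j}" by (auto elim!: oddE)
    then show "card {i. i < 2 * j + 1 \<and> odd i} = j" by (simp add: card_image inj_on_def)
  qed
  have "l * card (path_edges ` alt_lists V W 3) = card {i. i < k - 1 \<and> (even i \<longleftrightarrow> True)} * card ?B"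
    "l * card (path_edges ` alt_lists W V 3) = card {i. i < k - 1 \<and> (even i \<longleftrightarrow> False)} * card ?B"
    by (rule count, simp)+
  \<comment> \<open>Both types are equally numerous in the graph, so \<open>j + 1\<close> and
    \<open>j\<close> give the same product with the number of blocks. There are then no blocks,
    which contradicts \<open>l\<close> and \<open>pos\<close>.\<close>
  then have eqs: "l * card (path_edges ` alt_lists V W 3) = (j + 1) * card ?B"
    "l * card (path_edges ` alt_lists V W 3) = j * card ?B"
    unfolding j cp by (simp_all only: simp_thms ev)
  then have "card ?B = 0" by (metis mult_cancel2 n_not_Suc_n Suc_eq_plus1)
  then show False using eqs(2) l pos by simp
qed

text \<open>With an even number of vertices, a path has one end in each part, so reading it from its
  end in \<open>V\<close> covers every copy.\<close>

lemma path_copies_odd: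
  assumes "odd k"
  shows "path_copies k = path_edges ` alt_lists V W (k + 1)"
proof
  show "path_copies k \<subseteq> path_edges ` alt_lists V W (k + 1)"
  proof
    fix b assume "b \<in> path_copies k"
    then obtain ws where ws: "ws \<in> paths (k + 1)" "b = path_edges ws" by (auto simp: path_copies_def)
    have "rev ws \<in> alt_lists V W (k + 1)" if "ws \<in> alt_lists W V (k + 1)"
      using that assms alternating_rev[of W V ws] by (simp add: alt_lists_def)
    then show "b \<in> path_edges ` alt_lists V W (k + 1)"
      using ws path_edges_rev[of ws] unfolding paths_def by (metis UnE image_eqI)
  qed
qed (auto simp: path_copies_def paths_def)

end

section \<open>The group orbits of the path\<close>

locale enumerated_bipartition =
  fixes R C :: "nat \<Rightarrow> 'v" and m :: nat
  assumes inj_R: "inj_on R {1..m}" and inj_C: "inj_on C {1..m}"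
    and parts_disjoint: "vpart R m \<inter> vpart C m = {}"
begin

sublocale complete_bipartite "vpart R m" "vpart C m" m "interchange R C m"
proof
  have i: "interchange R C m (R i) = C i" "interchange R C m (C i) = R i" if "i \<in> {1..m}" for i
    using interchange_simps[OF inj_R inj_C parts_disjoint that] .
  show "interchange R C m ` vpart R m = vpart C m"
    unfolding vpart_def image_image by (rule image_cong[OF refl]) (rule i)
  show "interchange R C m ` vpart C m = vpart R m"
    unfolding vpart_def image_image by (rule image_cong[OF refl]) (rule i)
  show "interchange R C m permutes vpart R m \<union> vpart C m"
    using interchange_permutes[OF inj_R inj_C parts_disjoint] .
qed (use parts_disjoint card_image[OF inj_R] in \<open>auto simp: vpart_def\<close>)

abbreviation "RV \<equiv> vpart R m"
abbreviation "CV \<equiv> vpart C m"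

text \<open>This describes \<open>K\<close> by its action on the parts, the form in which
  permutations matching vertex lists are produced.\<close>

lemma K_group_iff: "g \<in> K_group R C m \<longleftrightarrow> g permutes (RV \<union> CV) \<and> g ` RV = RV \<and> g ` CV = CV"
proof
  assume "g \<in> K_group R C m"
  then obtain \<sigma> \<rho> where g: "g = \<sigma> \<circ> \<rho>" "\<sigma> permutes RV" "\<rho> permutes CV" by (auto simp: K_group_def)
  have "\<rho> ` RV = RV"
  proof -
    have "\<rho> x = x" if "x \<in> RV" for x
      using that g(3) parts_disjoint by (auto simp: permutes_def)
    then show ?thesis by simp
  qed
  moreover have "\<sigma> ` CV = CV"
  proof -
    have "\<sigma> x = x" if "x \<in> CV" for x
      using that g(2) parts_disjoint by (auto simp: permutes_def)
    then show ?thesis by simp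
  qed
  moreover have "\<sigma> ` RV = RV" "\<rho> ` CV = CV" using g permutes_image by auto
  ultimately have "g ` RV = RV" "g ` CV = CV" unfolding g(1) image_comp[symmetric] by simp_all
  moreover have "\<sigma> permutes (RV \<union> CV)" "\<rho> permutes (RV \<union> CV)"
    using g(2,3) permutes_subset by blast+
  then have "g permutes (RV \<union> CV)" unfolding g(1) by (intro permutes_compose)
  ultimately show "g permutes (RV \<union> CV) \<and> g ` RV = RV \<and> g ` CV = CV" by simp
next
  assume g: "g permutes (RV \<union> CV) \<and> g ` RV = RV \<and> g ` CV = CV"
  \<comment> \<open>The two factors are the restrictions of \<open>g\<close> to the parts, each
    extended by the identity.\<close>
  define r where "r A x = (if x \<in> A then g x else x)" for A x
  have inj: "inj_on g A" for A using permutes_inj_on[OF conjunct1[OF g]] .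
  have r: "r A permutes A" if "g ` A = A" for A
  proof (rule bij_imp_permutes)
    show "bij_betw (r A) A A"
      using inj[of A] that by (subst bij_betw_cong[of A _ g]) (simp_all add: r_def bij_betw_def)
  qed (simp add: r_def)
  have "g = r RV \<circ> r CV"
  proof
    fix x
    have "g x = x" if "x \<notin> RV" "x \<notin> CV" using g that by (simp add: permutes_def)
    moreover have "g x \<in> CV" "g x \<notin> RV" if "x \<in> CV" using g that parts_disjoint by auto
    ultimately show "g x = (r RV \<circ> r CV) x"
      using parts_disjoint by (auto simp: r_def)
  qed
  moreover have "r RV permutes RV" "r CV permutes CV" using r g by simp_all
  ultimately show "g \<in> K_group R C m" unfolding K_group_def by (intro CollectI exI conjI)
qed

text \<open>Every generator preserves or exchanges the parts, and this passes to inverses and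
  products.\<close>

lemma G_group_automorphism:
  assumes "g \<in> G_group R C m"
  shows "automorphism g"
  using assms unfolding G_group_def
proof (induction rule: generate.induct)
  case one
  then show ?case by (simp add: automorphism_def symm_grp_def permutes_def)
next
  case (incl h)
  then show ?case using swap K_group_iff by (auto simp: automorphism_def)
next
  case (inv h)
  let ?S = "symm_grp (RV \<union> CV)"
  interpret S: group ?S by (rule group_symm_grp)
  have h: "automorphism h" using inv swap K_group_iff by (auto simp: automorphism_def)
  then have hc: "h \<in> carrier ?S" by (simp add: automorphism_def symm_grp_def)
  have "inv\<^bsub>?S\<^esub> h \<in> carrier ?S" using S.inv_closed[OF hc] .
  then have p: "inv\<^bsub>?S\<^esub> h permutes (RV \<union> CV)" by (simp add: symm_grp_def)
  have "inv\<^bsub>?S\<^esub> h \<circ> h = id" using S.l_inv[OF hc] by (simp add: symm_grp_def)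
  then have "(inv\<^bsub>?S\<^esub> h) ` (h ` A) = A" for A by (simp add: image_comp)
  from this[of RV] this[of CV] show ?case using h p unfolding automorphism_def by auto
next
  case (eng h1 h2)
  then have a: "automorphism h1" "automorphism h2" by auto
  then have "automorphism (h1 \<circ> h2)"
    unfolding automorphism_def image_comp[symmetric]
    by (elim conjE disjE) (simp_all add: permutes_compose)
  then show ?case by (simp add: symm_grp_def comp_def)
qed

section \<open>Orbits of a path under both groups\<close>

lemma act_graph_path_edges: "act_graph g (path_edges ws) = path_edges (map g ws)"
  by (simp add: act_graph_def path_edges_map)

lemma K_orbit:
  assumes "ws \<in> alt_lists RV CV n"
  shows "{act_graph g (path_edges ws) | g. g \<in> K_group R C m} = path_edges ` alt_lists RV CV n"
proof (intro equalityI subsetI)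
  fix b assume "b \<in> {act_graph g (path_edges ws) | g. g \<in> K_group R C m}"
  then obtain g where g: "g permutes (RV \<union> CV)" "g ` RV = RV" "g ` CV = CV" and b: "b = path_edges (map g ws)"
    by (auto simp: K_group_iff act_graph_path_edges)
  have "map g ws \<in> alt_lists RV CV n"
    using assms alternating_map[of RV CV ws g] g permutes_inj[OF g(1)]
    by (simp add: alt_lists_def distinct_map inj_on_subset[of g UNIV])
  then show "b \<in> path_edges ` alt_lists RV CV n" using b by simp
next
  fix b assume "b \<in> path_edges ` alt_lists RV CV n"
  then obtain us where us: "us \<in> alt_lists RV CV n" "b = path_edges us" by blast
  obtain g where g: "g permutes (RV \<union> CV)" "g ` RV = RV" "g ` CV = CV" "map g ws = us"
    using ex_permutes_map_alternating[of RV CV ws us] us assms parts_disjoint by (auto simp: alt_lists_def)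
  then have "g \<in> K_group R C m" by (simp add: K_group_iff)
  then show "b \<in> {act_graph g (path_edges ws) | g. g \<in> K_group R C m}"
    using us(2) g(4) by (intro CollectI exI[of _ g]) (simp add: act_graph_path_edges)
qed

text \<open>Group elements keep paths paths. Conversely, a list starting in \<open>RV\<close> is
  reached by an element of \<open>K\<close>, and one starting in \<open>CV\<close> by the
  interchange followed by such an element.\<close>

lemma G_orbit:
  assumes "ws \<in> alt_lists RV CV n"
  shows "{act_graph g (path_edges ws) | g. g \<in> G_group R C m} = path_edges ` paths n"
proof (intro equalityI subsetI)
  fix b assume "b \<in> {act_graph g (path_edges ws) | g. g \<in> G_group R C m}"
  then obtain g where g: "g \<in> G_group R C m" "b = path_edges (map g ws)"
    by (auto simp: act_graph_path_edges)
  have "map g ws \<in> paths n"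
    using automorphism_paths[OF G_group_automorphism[OF g(1)]] assms by (auto simp: paths_def)
  then show "b \<in> path_edges ` paths n" using g(2) by simp
next
  fix b assume "b \<in> path_edges ` paths n"
  then obtain us where us: "us \<in> paths n" "b = path_edges us" by blast
  have KG: "g \<in> G_group R C m" if "g \<in> K_group R C m" for g
    unfolding G_group_def using that by (intro generate.incl) simp
  have "\<exists>g. g \<in> G_group R C m \<and> map g ws = us"
  proof (cases "us \<in> alt_lists RV CV n")
    case True
    then obtain g where g: "g permutes (RV \<union> CV)" "g ` RV = RV" "g ` CV = CV" "map g ws = us"
      using ex_permutes_map_alternating[of RV CV ws us] assms parts_disjoint by (auto simp: alt_lists_def)
    then have "g \<in> G_group R C m" using KG K_group_iff by simp
    then show ?thesis using g(4) by blast
  next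
    case False
    let ?ws = "map (interchange R C m) ws"
    have us': "us \<in> alt_lists CV RV n" using False us by (simp add: paths_def)
    have "alternating CV RV ?ws" "distinct ?ws" "length ?ws = n"
      using assms alternating_map[of RV CV ws "interchange R C m"] swap permutes_inj[OF swap(1)]
      by (simp_all add: alt_lists_def distinct_map inj_on_subset[of _ UNIV])
    then obtain g where g: "g permutes (CV \<union> RV)" "g ` RV = RV" "g ` CV = CV" "map g ?ws = us"
      using ex_permutes_map_alternating[of CV RV ?ws us] us' parts_disjoint
      by (auto simp: alt_lists_def Int_commute)
    then have "g \<in> G_group R C m" using KG K_group_iff by (simp add: Un_commute)
    moreover have "interchange R C m \<in> G_group R C m"
      unfolding G_group_def by (intro generate.incl) simp
    ultimately have "g \<otimes>\<^bsub>symm_grp (RV \<union> CV)\<^esub> interchange R C m \<in> G_group R C m"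
      unfolding G_group_def by (rule generate.eng)
    then have "g \<circ> interchange R C m \<in> G_group R C m" by (simp add: symm_grp_def comp_def)
    then show ?thesis using g(4) by (intro exI[of _ "g \<circ> interchange R C m"]) simp
  qed
  then obtain g where "g \<in> G_group R C m" "map g ws = us" by blast
  then show "b \<in> {act_graph g (path_edges ws) | g. g \<in> G_group R C m}"
    using us(2) by (intro CollectI exI[of _ g]) (simp add: act_graph_path_edges)
qed

text \<open>Sending a point to its edge is injective and undoes \<open>block\<close> on every set of
  edges in \<open>B\<close>, so the two structures are relabellings of each other.\<close>

lemma is_design_block_iff:
  assumes "B \<subseteq> Pow edges"
  shows "is_design t v k l (points R C m, block R C m ` B) \<longleftrightarrow> is_design t v k l (edges, B)"
proof -
  let ?f = "\<lambda>(x, y). {x, y}"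
  have "?f ` block R C m \<Gamma> = \<Gamma>" if "\<Gamma> \<in> B" for \<Gamma>
  proof -
    have "\<Gamma> \<subseteq> ?f ` points R C m" using assms that by (auto simp: edges_image points_def)
    then show ?thesis unfolding block_def by auto
  qed
  then have "(`) ?f ` block R C m ` B = B" by (simp add: image_image)
  moreover have "?f ` points R C m = edges" by (simp add: edges_image points_def)
  moreover have "is_design t v k l (?f ` points R C m, (`) ?f ` block R C m ` B) \<longleftrightarrow>
      is_design t v k l (points R C m, block R C m ` B)"
    by (rule is_design_image_iff) (use inj_on_pair_edge in \<open>auto simp: points_def block_def\<close>)
  ultimately show ?thesis by simp
qed

text \<open>The vertices are taken in the order \<open>R 1\<close>, \<open>C 1\<close>,
  \<open>R 2\<close>, \<open>C 2\<close> and so on. The largest index, \<open>k div 2 + 1\<close>,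
  still lies in the range where \<open>R\<close> and \<open>C\<close> are injective.\<close>

lemma ex_k_path:
  assumes "k div 2 + 1 \<le> m"
  shows "\<exists>ws \<in> alt_lists RV CV (k + 1). k_path R C k = path_edges ws"
proof -
  let ?w = "\<lambda>i. if even i then R (i div 2 + 1) else C (i div 2 + 1)"
  let ?ws = "map ?w [0..<k + 1]"
  have idx: "i div 2 + 1 \<in> {1..m}" if "i < k + 1" for i
    using that assms div_le_mono[of i k 2] by auto
  have part: "?w i \<in> (if even i then RV else CV)" if "i < k + 1" for i
    using idx[OF that] by (auto simp: vpart_def)
  have "inj_on ?w {0..<k + 1}"
  proof (rule inj_onI)
    fix i j assume ij: "i \<in> {0..<k + 1}" "j \<in> {0..<k + 1}" and eq: "?w i = ?w j"
    have par: "even i \<longleftrightarrow> even j"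
      using part[of i] part[of j] eq ij parts_disjoint by (auto split: if_splits)
    then have "i div 2 + 1 = j div 2 + 1"
      using eq ij idx[of i] idx[of j] inj_onD[OF inj_R] inj_onD[OF inj_C] by (auto split: if_splits)
    then show "i = j" using par by (metis add_right_cancel even_iff_mod_2_eq_zero div_mult_mod_eq odd_iff_mod_2_eq_one)
  qed
  then have "distinct ?ws" by (simp only: distinct_map distinct_upt set_upt simp_thms)
  moreover have nth: "?ws ! i = ?w i" if "i < k + 1" for i
    using that by (simp only: nth_map_upt diff_zero add_0)
  then have "alternating RV CV ?ws"
    using part unfolding alternating_iff_nth by (simp only: length_map length_upt diff_zero) simp
  ultimately have "?ws \<in> alt_lists RV CV (k + 1)" by (simp add: alt_lists_def)
  moreover have "k_path R C k = path_edges ?ws"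
  proof -
    have "path_edges ?ws = (\<lambda>i. {?w i, ?w (Suc i)}) ` {..<k}"
      unfolding path_edges_image using nth by (intro image_cong) auto
    also have "\<dots> = k_path R C k"
    proof (intro equalityI subsetI)
      fix e assume "e \<in> (\<lambda>i. {?w i, ?w (Suc i)}) ` {..<k}"
      then obtain i where i: "i < k" "e = {?w i, ?w (Suc i)}" by blast
      \<comment> \<open>Position \<open>2 * j\<close> yields the edge from \<open>R (j + 1)\<close>
        to \<open>C (j + 1)\<close>, and position \<open>2 * j + 1\<close> the edge from
        \<open>R (j + 2)\<close> to \<open>C (j + 1)\<close>.\<close>
      show "e \<in> k_path R C k"
      proof (cases "even i")
        case True
        then obtain j where "i = 2 * j" by (elim evenE)
        then have "e = {R (j + 1), C (j + 1)}" "1 \<le> j + 1 \<and> j + 1 \<le> (k + 1) div 2" using i by auto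
        then show ?thesis unfolding k_path_def by blast
      next
        case False
        then obtain j where "i = 2 * j + 1" by (elim oddE)
        then have "e = {R (j + 1 + 1), C (j + 1)}" "1 \<le> j + 1 \<and> j + 1 \<le> k div 2"
          using i by (auto simp: insert_commute)
        then show ?thesis unfolding k_path_def by blast
      qed
    next
      fix e assume "e \<in> k_path R C k"
      then consider j where "e = {R j, C j}" "1 \<le> j" "j \<le> (k + 1) div 2"
        | j where "e = {R (j + 1), C j}" "1 \<le> j" "j \<le> k div 2"
        unfolding k_path_def by blast
      then show "e \<in> (\<lambda>i. {?w i, ?w (Suc i)}) ` {..<k}"
      proof cases
        case 1
        then have "2 * (j - 1) \<in> {..<k}" "e = {?w (2 * (j - 1)), ?w (Suc (2 * (j - 1)))}" by auto
        then show ?thesis by blast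
      next
        case 2
        then obtain i where j: "j = Suc i" by (cases j) auto
        then have "2 * i + 1 \<in> {..<k}" "e = {?w (2 * i + 1), ?w (Suc (2 * i + 1))}"
          using 2 by (auto simp: insert_commute)
        then show ?thesis by blast
      qed
    qed
    finally show ?thesis by simp
  qed
  ultimately show ?thesis by blast
qed

lemma design_k_path:
  assumes "k div 2 + 1 \<le> m"
  shows "design R C m (k_path R C k) = (points R C m, block R C m ` path_edges ` alt_lists RV CV (k + 1))"
    and "design_hat R C m (k_path R C k) = (points R C m, block R C m ` path_copies k)"
proof -
  obtain ws where ws: "ws \<in> alt_lists RV CV (k + 1)" "k_path R C k = path_edges ws"
    using ex_k_path[OF assms] by blast
  have blocks: "{block R C m (act_graph g \<Delta>) | g. g \<in> H} = block R C m ` {act_graph g \<Delta> | g. g \<in> H}" for \<Delta> H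
    by blast
  show "design R C m (k_path R C k) = (points R C m, block R C m ` path_edges ` alt_lists RV CV (k + 1))"
    unfolding design_def blocks ws(2) K_orbit[OF ws(1)] ..
  show "design_hat R C m (k_path R C k) = (points R C m, block R C m ` path_copies k)"
    unfolding design_hat_def blocks ws(2) G_orbit[OF ws(1)] path_copies_def ..
qed

lemma is_design_k_path_iff:
  assumes "k div 2 + 1 \<le> m"
  shows "is_design t v k' l (design R C m (k_path R C k)) \<longleftrightarrow>
      is_design t v k' l (edges, path_edges ` alt_lists RV CV (k + 1))"
    and "is_design t v k' l (design_hat R C m (k_path R C k)) \<longleftrightarrow> is_design t v k' l (edges, path_copies k)"
proof -
  have "path_copies k \<subseteq> Pow edges" using path_copies_subset by blast
  moreover from this have "path_edges ` alt_lists RV CV (k + 1) \<subseteq> Pow edges"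
    by (auto simp: path_copies_def paths_def)
  ultimately show "is_design t v k' l (design R C m (k_path R C k)) \<longleftrightarrow>
      is_design t v k' l (edges, path_edges ` alt_lists RV CV (k + 1))"
    "is_design t v k' l (design_hat R C m (k_path R C k)) \<longleftrightarrow> is_design t v k' l (edges, path_copies k)"
    unfolding design_k_path[OF assms] by (simp_all only: is_design_block_iff)
qed

end

section \<open>The value of \<open>\<lambda>\<close>\<close>

text \<open>Each of the factors \<open>m\<close>, ..., \<open>m - p + 1\<close> occurs twice, so the
  product is the square of a quotient of factorials, stated free of division.\<close>

lemma prod_diff_half:
  assumes "p \<le> m"
  shows "(\<Prod>i<2 * p. m - i div 2) * (fact (m - p))\<^sup>2 = (fact m :: nat)\<^sup>2"
  using assms
proof (induction p)
  case (Suc p)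
  have "fact (m - p) = (m - p) * (fact (m - Suc p) :: nat)"
    using Suc.prems fact_reduce[of "m - p", where 'a = nat] by simp
  then have "(\<Prod>i<2 * Suc p. m - i div 2) * (fact (m - Suc p))\<^sup>2 =
      (\<Prod>i<2 * p. m - i div 2) * (fact (m - p) :: nat)\<^sup>2"
    by (simp add: power2_eq_square ac_simps)
  also have "\<dots> = (fact m)\<^sup>2" using Suc by simp
  finally show ?case .
qed simp

text \<open>From \<open>F = c * f\<close> follows \<open>F\<^sup>2 = c * (F * f)\<close>. The outer
  factor is what later cancels, and the product of two different factorials is the shape found in
  \<lambda>.\<close>

lemma fact_Suc_power2: "(fact (n + 1) :: nat)\<^sup>2 = (n + 1) * (fact (n + 1) * fact n)"
  and fact_add_2_power2: "(fact (n + 2) :: nat)\<^sup>2 = (n + 2) * (n + 1) * (fact (n + 2) * fact n)"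
proof -
  have sq: "F\<^sup>2 = c * (F * f)" if "F = c * f" for F c f :: nat
    using that by (simp add: power2_eq_square)
  show "(fact (n + 1) :: nat)\<^sup>2 = (n + 1) * (fact (n + 1) * fact n)"
    by (rule sq) simp
  show "(fact (n + 2) :: nat)\<^sup>2 = (n + 2) * (n + 1) * (fact (n + 2) * fact n)"
    by (rule sq) (simp add: algebra_simps)
qed

text \<open>With \<open>k = 2 * j + 3\<close> the path uses \<open>j + 2\<close> of the
  \<open>2 * j + 2\<close> vertices of each part. The \<open>j\<close> vertices left over in each
  part account for the squared factorial in the denominator.\<close>

lemma lambda_odd:
  assumes "odd k" "3 \<le> k" and l: "l * ((k - 1) * (k - 1 - 1)) = (\<Prod>i<k + 1. (k - 1) - i div 2)"
  shows "real l = fact (k - 1) * fact (k - 3) / (fact ((k - 3) div 2))\<^sup>2"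
proof -
  obtain i where "k = 2 * i + 1" using assms(1) by (elim oddE)
  then obtain j where j: "k = 2 * j + 3" using assms(2) by (intro that[of "i - 1"]) simp
  have "l * ((2 * j + 2) * (2 * j + 1)) = (\<Prod>i<2 * (j + 2). (2 * j + 2) - i div 2)"
  proof -
    have "k - 1 - 1 = 2 * j + 1" "k - 1 = 2 * j + 2" "k + 1 = 2 * (j + 2)" using j by simp_all
    then show ?thesis using l by metis
  qed
  then have "l * ((2 * j + 2) * (2 * j + 1)) * (fact j)\<^sup>2 = (fact (2 * j + 2))\<^sup>2"
    using prod_diff_half[of "j + 2" "2 * j + 2"] by (simp del: prod.lessThan_Suc fact_Suc)
  also have "\<dots> = (2 * j + 2) * (2 * j + 1) * (fact (2 * j + 2) * fact (2 * j))"
    by (rule fact_add_2_power2)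
  finally have "((2 * j + 2) * (2 * j + 1)) * (l * (fact j)\<^sup>2) =
      ((2 * j + 2) * (2 * j + 1)) * (fact (2 * j + 2) * fact (2 * j))"
    by (simp only: ac_simps)
  then have "l * (fact j)\<^sup>2 = fact (2 * j + 2) * fact (2 * j)" unfolding mult_cancel1 by simp
  then have "real (l * (fact j)\<^sup>2) = real (fact (2 * j + 2) * fact (2 * j))" by (rule arg_cong)
  then have "real l * (fact j)\<^sup>2 = fact (2 * j + 2) * fact (2 * j)" by (simp only: of_nat_mult of_nat_power of_nat_fact)
  then show ?thesis by (simp add: j eq_divide_eq del: fact_Suc)
qed

text \<open>With \<open>k = 2 * j + 4\<close> one part contributes \<open>j + 2\<close> vertices and
  the other \<open>j + 3\<close>, which leaves \<open>j + 1\<close> and \<open>j\<close> of the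
  \<open>2 * j + 3\<close> vertices and so the two different factorials in the denominator.\<close>

lemma lambda_even:
  assumes "even k" "4 \<le> k" and l: "l * ((k - 1) * (k - 1 - 1)) = (\<Prod>i<k + 1. (k - 1) - i div 2)"
  shows "real l = fact (k - 1) * fact (k - 3) / (fact (k div 2 - 2) * fact (k div 2 - 1))"
proof -
  obtain i where "k = 2 * i" using assms(1) by (elim evenE)
  then obtain j where j: "k = 2 * j + 4" using assms(2) by (intro that[of "i - 2"]) simp
  have "l * ((2 * j + 3) * (2 * j + 2)) = (\<Prod>i<Suc (2 * (j + 2)). (2 * j + 3) - i div 2)"
  proof -
    have "k - 1 - 1 = 2 * j + 2" "k - 1 = 2 * j + 3" "k + 1 = Suc (2 * (j + 2))" using j by simp_all
    then show ?thesis using l by metis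
  qed
  \<comment> \<open>The odd number of vertices leaves one unpaired factor,
    \<open>(2 * j + 3) - (j + 2) = j + 1\<close>; it cancels later against the one split off the
    square of \<open>fact (j + 1)\<close>.\<close>
  also have "\<dots> = (\<Prod>i<2 * (j + 2). (2 * j + 3) - i div 2) * (j + 1)"
    by (subst prod.lessThan_Suc) simp
  finally have "l * ((2 * j + 3) * (2 * j + 2)) * (fact (j + 1))\<^sup>2 =
      (\<Prod>i<2 * (j + 2). (2 * j + 3) - i div 2) * (fact (j + 1))\<^sup>2 * (j + 1)"
    by (simp only: ac_simps)
  also have "\<dots> = (fact (2 * j + 3))\<^sup>2 * (j + 1)"
    using prod_diff_half[of "j + 2" "2 * j + 3"] by (simp del: prod.lessThan_Suc fact_Suc)
  also have "\<dots> = (2 * j + 3) * (2 * j + 2) * (fact (2 * j + 3) * fact (2 * j + 1)) * (j + 1)"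
    using fact_add_2_power2[of "2 * j + 1"] by (simp only: add.assoc one_plus_numeral numeral_One one_add_one) simp
  finally have "((2 * j + 3) * (2 * j + 2) * (j + 1)) * (l * (fact j * fact (j + 1))) =
      ((2 * j + 3) * (2 * j + 2) * (j + 1)) * (fact (2 * j + 3) * fact (2 * j + 1))"
    unfolding fact_Suc_power2 by (simp only: ac_simps)
  then have "l * (fact j * fact (j + 1)) = fact (2 * j + 3) * fact (2 * j + 1)" unfolding mult_cancel1 by simp
  then have "real (l * (fact j * fact (j + 1))) = real (fact (2 * j + 3) * fact (2 * j + 1))" by (rule arg_cong)
  then have "real l * (fact j * fact (j + 1)) = fact (2 * j + 3) * fact (2 * j + 1)" by (simp only: of_nat_mult of_nat_fact)
  moreover have "k - 1 = 2 * j + 3" "k - 3 = 2 * j + 1" "k div 2 - 2 = j" "k div 2 - 1 = j + 1"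
    using j by simp_all
  ultimately show ?thesis by (simp add: eq_divide_eq del: fact_Suc)
qed

theorem lemma4p2:
  fixes R C :: "nat \<Rightarrow> 'v" and k m :: nat
  assumes "inj_on R {1..m}" and "inj_on C {1..m}" and "vpart R m \<inter> vpart C m = {}"
    and "k \<ge> 3" and "real k \<le> (real m)^2 / 2" and "m \<ge> k div 2 + 1"
  defines "\<Delta> \<equiv> k_path R C k"
  shows "\<not> is_t_design 3 (design_hat R C m \<Delta>) \<and>
    (is_t_design 2 (design_hat R C m \<Delta>) \<longleftrightarrow> m = k - 1) \<and>
    (m = k - 1 \<longrightarrow>
      (odd k \<longrightarrow>
        design_hat R C m \<Delta> = design R C m \<Delta> \<and> is_t_design 2 (design R C m \<Delta>) \<and>
        (\<exists>l. real l = fact (k - 1) * fact (k - 3) / (fact ((k - 3) div 2))^2 \<and>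
             is_design 2 ((k - 1)^2) k l (design_hat R C m \<Delta>))) \<and>
      (even k \<longrightarrow>
        design_hat R C m \<Delta> \<noteq> design R C m \<Delta> \<and> \<not> is_t_design 2 (design R C m \<Delta>) \<and>
        (\<exists>l. real l = fact (k - 1) * fact (k - 3) / (fact (k div 2 - 2) * fact (k div 2 - 1)) \<and>
             is_design 2 ((k - 1)^2) k l (design_hat R C m \<Delta>))))"
proof -
  interpret enumerated_bipartition R C m by unfold_locales fact+
  \<comment> \<open>For \<open>m \<le> 2\<close> the bound on \<open>k\<close> would give
    \<open>k \<le> 2\<close>.\<close>
  have m3: "3 \<le> m"
  proof (rule ccontr)
    assume "\<not> 3 \<le> m"
    then have "(real m)\<^sup>2 \<le> 2\<^sup>2" by (intro power_mono) auto
    then show False using assms(4,5) by simp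
  qed
  have iff: "is_design t v k' l (design_hat R C m \<Delta>) \<longleftrightarrow> is_design t v k' l (edges, path_copies k)"
    "is_design t v k' l (design R C m \<Delta>) \<longleftrightarrow>
      is_design t v k' l (edges, path_edges ` alt_lists RV CV (k + 1))" for t v k' l
    unfolding \<Delta>_def using is_design_k_path_iff[OF assms(6)] by auto
  have cc: "card (path_copies k) = (\<Prod>i<k + 1. m - i div 2)"
    using assms(4) by (intro card_path_copies) simp
  \<comment> \<open>No factor vanishes, since \<open>i div 2\<close> is at most
    \<open>k div 2\<close>, which is below \<open>m\<close>.\<close>
  have pos: "0 < card (path_copies k)"
    unfolding cc
  proof (rule prod_pos)
    fix i assume "i \<in> {..<k + 1}"
    then have "i div 2 \<le> k div 2" by (intro div_le_mono) simp
    then show "0 < m - i div 2" using assms(6) by simp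
  qed
  have hat3: "\<not> is_t_design 3 (design_hat R C m \<Delta>)"
    using not_three_design[OF m3] unfolding is_t_design_def iff .
  have order: "m = k - 1" if "is_t_design 2 (design_hat R C m \<Delta>)"
  proof -
    obtain v k' l where "is_design 2 v k' l (edges, path_copies k)"
      using \<open>is_t_design 2 (design_hat R C m \<Delta>)\<close> unfolding is_t_design_def iff by blast
    then show ?thesis by (rule two_design_order) (use m3 assms(4) pos in simp_all)
  qed
  have two: "\<exists>l. l * ((k - 1) * (k - 1 - 1)) = (\<Prod>i<k + 1. (k - 1) - i div 2) \<and>
      is_design 2 ((k - 1)\<^sup>2) k l (design_hat R C m \<Delta>)" if "m = k - 1"
    using two_design[OF that assms(4) pos] unfolding iff cc by (simp only: that)
  then have hat2: "is_t_design 2 (design_hat R C m \<Delta>)" if "m = k - 1"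
    using that unfolding is_t_design_def by blast
  have odd: "design_hat R C m \<Delta> = design R C m \<Delta>" if "odd k"
    unfolding \<Delta>_def design_k_path[OF assms(6)] path_copies_odd[OF that] ..
  have even: "\<not> is_t_design 2 (design R C m \<Delta>)" if "even k"
    using one_sided_not_two_design[OF that] assms(4) m3 unfolding is_t_design_def iff by simp
  have l_odd: "\<exists>l. real l = fact (k - 1) * fact (k - 3) / (fact ((k - 3) div 2))^2 \<and>
      is_design 2 ((k - 1)^2) k l (design_hat R C m \<Delta>)" if "m = k - 1" "odd k"
    using two[OF that(1)] lambda_odd[OF that(2) assms(4)] by blast
  have l_even: "\<exists>l. real l = fact (k - 1) * fact (k - 3) / (fact (k div 2 - 2) * fact (k div 2 - 1)) \<and>
      is_design 2 ((k - 1)^2) k l (design_hat R C m \<Delta>)" if "m = k - 1" "even k"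
  proof -
    \<comment> \<open>An even \<open>k \<ge> 3\<close> is at least \<open>4\<close>, so the
      subtraction in \<open>k div 2 - 2\<close> is a true one.\<close>
    have "k \<noteq> 3" using that(2) by auto
    then have "4 \<le> k" using assms(4) by simp
    then show ?thesis using two[OF that(1)] lambda_even[OF that(2)] by blast
  qed
  show ?thesis
  proof (intro conjI impI)
    show "is_t_design 2 (design_hat R C m \<Delta>) \<longleftrightarrow> m = k - 1" using order hat2 by (rule iffI)
    show "is_t_design 2 (design R C m \<Delta>)" if "m = k - 1" "odd k"
      using hat2[OF that(1)] unfolding odd[OF that(2)] .
    \<comment> \<open>Only one of the two structures is a two-design, so they differ.\<close>
    show "design_hat R C m \<Delta> \<noteq> design R C m \<Delta>" if "m = k - 1" "even k"
    proof
      assume "design_hat R C m \<Delta> = design R C m \<Delta>"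
      then show False using hat2[OF that(1)] even[OF that(2)] by (simp only:)
    qed
  qed (rule hat3 odd even l_odd l_even, assumption?, assumption?)+
qed

end
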